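(* Let $\Bbbk$ be an algebraically closed field of characteristic zero, let $\mathbb A=\Bbbk[x,y,z]/(x^2z-y^2-1)$, and let $\sigma$ be the $\Bbbk$-algebra automorphism of $\mathbb A$ given by $\sigma(\bar x)=-\bar x$, $\sigma(\bar y)=-\bar y$, $\sigma(\bar z)=\bar z$. Then there exists a simple derivation $D\in\operatorname{Der}_{\Bbbk}(\mathbb A)$ whose restriction to the invariant ring $\mathbb B=\mathbb A^{\langle\sigma\rangle}$ is the derivation $\mathcal D$ of $\mathbb B$ (given in the context), and such that $\sigma D=D\sigma$. In particular, $\sigma\in\operatorname{Aut}_D(\mathbb A)$ and $\operatorname{Aut}_D(\mathbb A)\neq\{\operatorname{id}\}$.
   Context: $\bar x,\bar y,\bar z$ are the images of $x,y,z$ in $\mathbb A$. The invariant ring $\mathbb A^{\langle\sigma\rangle}=\{a\in\mathbb A\mid\sigma(a)=a\}$ is generated by $u=\bar x^2$, $v=\bar x\bar y$, $w=\bar z$, and is identified with $\mathbb B=\Bbbk[u,v,w]/(u^2w-v^2-u)$. The derivation $\mathcal D\in\operatorname{Der}_{\Bbbk}(\mathbb B)$ is defined by $\mathcal D(w)=1$, $\mathcal D(u)=v+u^2w-u-u^2$, $\mathcal D(v)=uvw-uv+uw-\frac{v+1}{2}$. $\operatorname{Der}_{\Bbbk}(A)$ is the space of $\Bbbk$-derivations of $A$; a derivation $D$ of $A$ is simple if the only ideals $I\subseteq A$ with $D(I)\subseteq I$ are $0$ and $A$; $\operatorname{Aut}_D(A)$ is the group of $\Bbbk$-algebra automorphisms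 of $A$ commuting with $D$. *)

theory Defs
  imports "HOL-Computational_Algebra.Computational_Algebra" "HOL-Library.FuncSet"
begin

section \<open>The algebra \<open>A = k[x,y,z]/(x\<^sup>2z - y\<^sup>2 - 1)\<close>\<close>

text \<open>
  The polynomial ring in three variables is the iterated polynomial ring \<open>k[x][z][y]\<close>: the
  innermost variable is \<open>x\<close> and the outermost one is \<open>y\<close>. With this order the defining
  polynomial is, up to sign, monic in the outermost variable.
\<close>

definition pX :: "'k::field poly poly poly" where "pX = [:[:[:0, 1:]:]:]"
definition pZ :: "'k::field poly poly poly" where "pZ = [:[:0, 1:]:]"
definition pY :: "'k::field poly poly poly" where "pY = [:0, 1:]"
definition pC :: "'k::field \<Rightarrow> 'k poly poly poly" where "pC c = [:[:[:c:]:]:]"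

definition surface_poly :: "'k::field poly poly poly" where
  "surface_poly = pX ^ 2 * pZ - pY ^ 2 - 1"

definition surface_rel :: "'k::field poly poly poly \<Rightarrow> 'k poly poly poly \<Rightarrow> bool" where
  "surface_rel p q \<longleftrightarrow> surface_poly dvd (p - q)"

lemma surface_rel_equivp: "equivp (surface_rel :: 'k::field poly poly poly \<Rightarrow> _)"
proof (rule equivpI)
  show "reflp (surface_rel :: 'k poly poly poly \<Rightarrow> _)" by (simp add: reflp_def surface_rel_def)
  show "symp (surface_rel :: 'k poly poly poly \<Rightarrow> _)"
    unfolding symp_def surface_rel_def by (metis dvd_minus_iff minus_diff_eq)
  show "transp (surface_rel :: 'k poly poly poly \<Rightarrow> _)"
  proof (rule transpI)
    fix p q r :: "'k poly poly poly"
    assume "surface_rel p q" "surface_rel q r"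
    then have "surface_poly dvd (p - q) + (q - r)"
      unfolding surface_rel_def by (rule dvd_add)
    then show "surface_rel p r" by (simp add: surface_rel_def)
  qed
qed

quotient_type (overloaded) 'k surface = "'k::field poly poly poly" / surface_rel
  by (rule surface_rel_equivp)

lemma surface_rel_mult:
  assumes "surface_rel p p'" "surface_rel q q'"
  shows "surface_rel (p * q) (p' * q')"
proof -
  have "p * q - p' * q' = (p - p') * q + p' * (q - q')" by (simp add: algebra_simps)
  with assms show ?thesis by (simp add: surface_rel_def)
qed

lemma surface_rel_add:
  assumes "surface_rel p p'" "surface_rel q q'"
  shows "surface_rel (p + q) (p' + q')"
proof -
  have "p + q - (p' + q') = (p - p') + (q - q')" by simp
  with assms show ?thesis by (simp only: surface_rel_def dvd_add)
qed

lemma surface_rel_diff: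
  assumes "surface_rel p p'" "surface_rel q q'"
  shows "surface_rel (p - q) (p' - q')"
proof -
  have "p - q - (p' - q') = (p - p') - (q - q')" by simp
  with assms show ?thesis by (simp only: surface_rel_def dvd_diff)
qed

lemma surface_poly_not_unit: "\<not> surface_poly dvd (1 :: 'k::field poly poly poly)"
proof
  assume "surface_poly dvd (1 :: 'k poly poly poly)"
  moreover have "degree (surface_poly :: 'k poly poly poly) = 2"
  proof -
    have eq: "(surface_poly :: 'k poly poly poly) = [: [:-1, [:0, 0, 1:]:], 0, -1:]"
      by (simp add: surface_poly_def pX_def pY_def pZ_def power2_eq_square one_pCons)
    show ?thesis unfolding eq by simp
  qed
  ultimately show False
    using dvd_imp_degree_le[of surface_poly "1 :: 'k poly poly poly"] by simp
qed

instantiation surface :: (field) comm_ring_1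
begin

lift_definition zero_surface :: "'a surface" is 0 .
lift_definition one_surface :: "'a surface" is 1 .
lift_definition plus_surface :: "'a surface \<Rightarrow> 'a surface \<Rightarrow> 'a surface" is "(+)"
  by (rule surface_rel_add)
lift_definition minus_surface :: "'a surface \<Rightarrow> 'a surface \<Rightarrow> 'a surface" is "(-)"
  by (rule surface_rel_diff)
lift_definition uminus_surface :: "'a surface \<Rightarrow> 'a surface" is uminus
  using surface_rel_diff[of 0 0] by (simp add: surface_rel_def)
lift_definition times_surface :: "'a surface \<Rightarrow> 'a surface \<Rightarrow> 'a surface" is "(*)"
  by (rule surface_rel_mult)

instance
proof
  fix a b c :: "'a surface"
  show "a * b * c = a * (b * c)" by transfer (simp add: surface_rel_def algebra_simps)
  show "a * b = b * a" by transfer (simp add: surface_rel_def algebra_simps)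
  show "1 * a = a" by transfer (simp add: surface_rel_def)
  show "a + b + c = a + (b + c)" by transfer (simp add: surface_rel_def algebra_simps)
  show "a + b = b + a" by transfer (simp add: surface_rel_def algebra_simps)
  show "0 + a = a" by transfer (simp add: surface_rel_def)
  show "- a + a = 0" by transfer (simp add: surface_rel_def)
  show "a - b = a + - b" by transfer (simp add: surface_rel_def)
  show "(a + b) * c = a * c + b * c" by transfer (simp add: surface_rel_def algebra_simps)
  show "(0 :: 'a surface) \<noteq> 1"
    by transfer (simp add: surface_rel_def surface_poly_not_unit)
qed

end

lift_definition const :: "'k::field \<Rightarrow> 'k surface" is pC .
lift_definition xbar :: "'k::field surface" is pX .
lift_definition ybar :: "'k::field surface" is pY .
lift_definition zbar :: "'k::field surface" is pZ .

lemma surface_equation: "xbar ^ 2 * zbar - ybar ^ 2 - 1 = (0 :: 'k::field surface)"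
  unfolding power2_eq_square
  by transfer (simp add: surface_rel_def surface_poly_def power2_eq_square)

section \<open>Ideals, derivations and automorphisms\<close>

definition is_ideal :: "'a::comm_ring_1 set \<Rightarrow> bool" where
  "is_ideal I \<longleftrightarrow> 0 \<in> I \<and> (\<forall>a\<in>I. \<forall>b\<in>I. a + b \<in> I) \<and> (\<forall>r. \<forall>a\<in>I. r * a \<in> I)"

text \<open>
  \<open>Der S\<close> are the \<open>k\<close>-derivations of a \<open>k\<close>-subalgebra \<open>S\<close> of \<open>A\<close>, as extensional
  functions, so that equality of derivations of \<open>S\<close> is equality of functions.
\<close>

definition Der :: "'k::field surface set \<Rightarrow> ('k surface \<Rightarrow> 'k surface) set" where
  "Der S = {d \<in> S \<rightarrow>\<^sub>E S.
     (\<forall>a\<in>S. \<forall>b\<in>S. d (a + b) = d a + d b) \<and>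
     (\<forall>c. \<forall>a\<in>S. d (const c * a) = const c * d a) \<and>
     (\<forall>a\<in>S. \<forall>b\<in>S. d (a * b) = d a * b + a * d b)}"

definition simple_derivation :: "('k::field surface \<Rightarrow> 'k surface) \<Rightarrow> bool" where
  "simple_derivation D \<longleftrightarrow>
     (\<forall>I. is_ideal I \<and> D ` I \<subseteq> I \<longrightarrow> I = {0} \<or> I = UNIV)"

definition alg_automorphism :: "('k::field surface \<Rightarrow> 'k surface) \<Rightarrow> bool" where
  "alg_automorphism \<phi> \<longleftrightarrow> bij \<phi> \<and>
     (\<forall>a b. \<phi> (a + b) = \<phi> a + \<phi> b) \<and>
     (\<forall>a b. \<phi> (a * b) = \<phi> a * \<phi> b) \<and>
     (\<forall>c. \<phi> (const c) = const c)"

definition Aut_commuting ::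
    "('k::field surface \<Rightarrow> 'k surface) \<Rightarrow> ('k surface \<Rightarrow> 'k surface) set" where
  "Aut_commuting D = {\<phi>. alg_automorphism \<phi> \<and> \<phi> \<circ> D = D \<circ> \<phi>}"

section \<open>The involution and its invariant ring\<close>

text \<open>On polynomials, \<open>p(x,y,z)\<close> is sent to \<open>p(-x,-y,z)\<close>.\<close>

definition psigma :: "'k::field poly poly poly \<Rightarrow> 'k poly poly poly" where
  "psigma p = pcompose (map_poly (map_poly (\<lambda>q. pcompose q [:0, -1:])) p) [:0, -1:]"

lemma map_poly_additive:
  fixes h :: "'a::comm_ring_1 \<Rightarrow> 'a"
  assumes "h 0 = 0" "\<And>a b. h (a + b) = h a + h b"
  shows "map_poly h (p + q) = map_poly h p + map_poly h q"
  by (rule poly_eqI) (simp add: coeff_map_poly assms)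

lemma additive_sum:
  fixes h :: "'a::comm_ring_1 \<Rightarrow> 'a"
  assumes "h 0 = 0" "\<And>a b. h (a + b) = h a + h b"
  shows "h (sum f A) = (\<Sum>i\<in>A. h (f i))"
  using assms by (induction A rule: infinite_finite_induct) auto

lemma map_poly_multiplicative:
  fixes h :: "'a::comm_ring_1 \<Rightarrow> 'a"
  assumes "h 0 = 0" "\<And>a b. h (a + b) = h a + h b" "\<And>a b. h (a * b) = h a * h b"
  shows "map_poly h (p * q) = map_poly h p * map_poly h q"
  by (rule poly_eqI) (simp add: coeff_map_poly coeff_mult additive_sum[of h] assms)

lemma map_poly_leibniz:
  fixes h :: "'a::comm_ring_1 \<Rightarrow> 'a"
  assumes "h 0 = 0" "\<And>a b. h (a + b) = h a + h b"
    "\<And>a b. h (a * b) = h a * b + a * h b"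
  shows "map_poly h (p * q) = map_poly h p * q + p * map_poly h q"
  by (rule poly_eqI)
    (simp add: coeff_map_poly coeff_mult additive_sum[of h] assms sum.distrib)

lemma psigma_add: "psigma (p + q) = psigma p + psigma q"
  by (simp add: psigma_def map_poly_additive pcompose_add)

lemma psigma_mult: "psigma (p * q) = psigma p * psigma q"
  by (simp add: psigma_def map_poly_additive map_poly_multiplicative pcompose_add pcompose_mult)

lemma psigma_gens:
  "psigma pX = - pX" "psigma pY = - pY" "psigma pZ = pZ" "psigma (pC c) = pC c"
  by (simp_all add: psigma_def pX_def pY_def pZ_def pC_def map_poly_pCons pcompose_pCons one_pCons)

lemma psigma_surface_poly: "psigma surface_poly = surface_poly"
proof -
  have m1: "psigma (-1) = -1"
    using psigma_gens(4)[of "-1"] by (simp add: pC_def one_pCons)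
  have uminus: "psigma (- p) = - psigma p" for p
    using psigma_mult[of "-1" p] unfolding m1 by simp
  have diff: "psigma (p - q) = psigma p - psigma q" for p q
    using psigma_add[of p "- q"] uminus[of q] by simp
  show ?thesis
    using uminus[of "-1"] unfolding m1
    by (simp add: surface_poly_def diff psigma_mult psigma_gens power2_eq_square)
qed

lift_definition sigma :: "'k::field surface \<Rightarrow> 'k surface" is psigma
proof -
  fix p q :: "'k poly poly poly"
  assume "surface_rel p q"
  then obtain r where "p = q + surface_poly * r"
    by (auto simp: surface_rel_def dvd_def algebra_simps)
  then have "psigma p = psigma q + surface_poly * psigma r"
    by (simp add: psigma_add psigma_mult psigma_surface_poly)
  then show "surface_rel (psigma p) (psigma q)" by (simp add: surface_rel_def)
qed

lemma sigma_add: "sigma (a + b) = sigma a + sigma b"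
  by transfer (simp add: psigma_add surface_rel_def)

lemma sigma_mult: "sigma (a * b) = sigma a * sigma b"
  by transfer (simp add: psigma_mult surface_rel_def)

lemma sigma_gens:
  "sigma xbar = - xbar" "sigma ybar = - ybar" "sigma zbar = zbar" "sigma (const c) = const c"
  by (transfer, simp add: psigma_gens surface_rel_def)+

lemma const_add: "const (c + d) = const c + const d"
  by transfer (simp add: pC_def surface_rel_def)

lemma const_mult: "const (c * d) = const c * const d"
  by transfer (simp add: pC_def surface_rel_def)

lemma const_0: "const 0 = 0" and const_1: "const 1 = 1"
  by (transfer, simp add: pC_def surface_rel_def one_pCons)+

lemma const_uminus: "const (- c) = - const c"
  using const_add[of c "- c"] by (simp add: const_0 eq_neg_iff_add_eq_0 add.commute)

lemma sigma_uminus: "sigma (- a) = - sigma a"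
  using sigma_mult[of "const (-1)" a] unfolding sigma_gens by (simp add: const_uminus const_1)

lemma sigma_diff: "sigma (a - b) = sigma a - sigma b"
  using sigma_add[of a "- b"] by (simp add: sigma_uminus)

text \<open>\<open>A\<close> is generated by the classes of \<open>x\<close>, \<open>y\<close>, \<open>z\<close> as a \<open>k\<close>-algebra.\<close>

lemma surface_induct [case_names const add x y z]:
  fixes P :: "'k::field surface \<Rightarrow> bool" and a :: "'k surface"
  assumes const: "\<And>c. P (const c)" and add: "\<And>a b. P a \<Longrightarrow> P b \<Longrightarrow> P (a + b)"
    and x: "\<And>a. P a \<Longrightarrow> P (xbar * a)" and y: "\<And>a. P a \<Longrightarrow> P (ybar * a)"
    and z: "\<And>a. P a \<Longrightarrow> P (zbar * a)"
  shows "P a"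
proof -
  let ?abs = "abs_surface :: 'k poly poly poly \<Rightarrow> _"
  have 1: "P (?abs [:[:p:]:])" for p
  proof (induction p)
    case 0
    have "?abs [:[:0:]:] = const 0" by (simp add: const.abs_eq pC_def)
    then show ?case using const by metis
  next
    case (pCons c p)
    have "[:[:pCons c p:]:] = pC c + pX * [:[:p:]:]" by (simp add: pC_def pX_def)
    then have "?abs [:[:pCons c p:]:] = const c + xbar * ?abs [:[:p:]:]"
      by (simp only: const.abs_eq xbar_def plus_surface.abs_eq times_surface.abs_eq)
    then show ?case using const add x pCons.IH by metis
  qed
  have 2: "P (?abs [:p:])" for p
  proof (induction p)
    case 0
    show ?case using 1[of 0] by simp
  next
    case (pCons c p)
    have "[:pCons c p:] = [:[:c:]:] + pZ * [:p:]" by (simp add: pZ_def)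
    then have "?abs [:pCons c p:] = ?abs [:[:c:]:] + zbar * ?abs [:p:]"
      by (simp only: zbar_def plus_surface.abs_eq times_surface.abs_eq)
    then show ?case using 1 add z pCons.IH by metis
  qed
  have 3: "P (?abs p)" for p
  proof (induction p)
    case 0
    show ?case using 2[of 0] by simp
  next
    case (pCons c p)
    have "pCons c p = [:c:] + pY * p" by (simp add: pY_def)
    then have "?abs (pCons c p) = ?abs [:c:] + ybar * ?abs p"
      by (simp only: ybar_def plus_surface.abs_eq times_surface.abs_eq)
    then show ?case using 2 add y pCons.IH by metis
  qed
  show ?thesis by (rule surface.abs_induct[of P]) (rule 3)
qed

lemma sigma_sigma: "sigma (sigma a) = a"
  by (induction a rule: surface_induct)
    (simp_all add: sigma_add sigma_mult sigma_gens sigma_uminus)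

lemma sigma_automorphism: "alg_automorphism sigma"
  unfolding alg_automorphism_def
  by (auto simp: sigma_add sigma_mult sigma_gens intro!: o_bij[of sigma sigma] sigma_sigma)

text \<open>
  The invariant ring is taken as a subalgebra of \<open>A\<close>; \<open>ubar\<close>, \<open>vbar\<close>, \<open>wbar\<close> are its
  generators \<open>u\<close>, \<open>v\<close>, \<open>w\<close> (lemma \<open>B_ring_generated\<close> below).
\<close>

definition B_ring :: "'k::field surface set" where
  "B_ring = {a. sigma a = a}"

definition ubar :: "'k::field surface" where "ubar = xbar ^ 2"
definition vbar :: "'k::field surface" where "vbar = xbar * ybar"
definition wbar :: "'k::field surface" where "wbar = zbar"

lemma ybar_squared: "ybar ^ 2 = xbar ^ 2 * zbar - (1 :: 'k::field surface)"
proof -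
  have "ybar ^ 2 = xbar ^ 2 * zbar - 1 - (xbar ^ 2 * zbar - ybar ^ 2 - (1 :: 'k surface))"
    by simp
  then show ?thesis unfolding surface_equation by simp
qed

lemma uvw_relation: "ubar ^ 2 * wbar - vbar ^ 2 - ubar = (0 :: 'k::field surface)"
proof -
  have "ubar ^ 2 * wbar - vbar ^ 2 - ubar
    = (xbar ^ 2 :: 'k surface) * (xbar ^ 2 * zbar - ybar ^ 2 - 1)"
    by (simp add: ubar_def vbar_def wbar_def algebra_simps power2_eq_square)
  then show ?thesis by (simp add: surface_equation)
qed

lemma B_ring_closed:
  "const c \<in> B_ring" "ubar \<in> B_ring" "vbar \<in> B_ring" "wbar \<in> B_ring"
  "a \<in> B_ring \<Longrightarrow> b \<in> B_ring \<Longrightarrow> a + b \<in> B_ring"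
  "a \<in> B_ring \<Longrightarrow> b \<in> B_ring \<Longrightarrow> a * b \<in> B_ring"
  by (simp_all add: B_ring_def ubar_def vbar_def wbar_def sigma_add sigma_mult sigma_gens
      power2_eq_square)

lemma B_ring_generated:
  fixes S :: "'k::field_char_0 surface set"
  assumes c: "\<And>c. const c \<in> S" and u: "ubar \<in> S" and v: "vbar \<in> S" and w: "wbar \<in> S"
    and add: "\<And>a b. a \<in> S \<Longrightarrow> b \<in> S \<Longrightarrow> a + b \<in> S"
    and mult: "\<And>a b. a \<in> S \<Longrightarrow> b \<in> S \<Longrightarrow> a * b \<in> S"
  shows "B_ring \<subseteq> S"
proof
  let ?S = "S \<inter> B_ring"
  note cl = B_ring_closed
  have zero: "0 \<in> ?S" using c[of 0] cl(1)[of 0] by (simp add: const_0)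
  have y2: "ybar * ybar = ubar * wbar + const (-1 :: 'k)"
    using ybar_squared[where 'k='k]
    by (simp add: ubar_def wbar_def const_uminus const_1 power2_eq_square)
  have gens: "const d \<in> ?S" "ubar \<in> ?S" "vbar \<in> ?S" "wbar \<in> ?S" for d
    by (simp_all add: c u v w cl)
  have Sadd: "p + q \<in> ?S" and Smult: "p * q \<in> ?S" if "p \<in> ?S" "q \<in> ?S" for p q
    using that by (simp_all add: add mult cl)
  define Q where "Q a \<longleftrightarrow> (\<exists>s t r. s \<in> ?S \<and> t \<in> ?S \<and> r \<in> ?S \<and>
    a = s + xbar * t + ybar * r)" for a
  have QI: "Q a" if "s \<in> ?S" "t \<in> ?S" "r \<in> ?S" "a = s + xbar * t + ybar * r" for a s t r
    unfolding Q_def using that by blast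
  have decomp: "Q a" for a
  proof (induction a rule: surface_induct)
    case (const d)
    show ?case by (rule QI[OF gens(1)[of d] zero zero]) simp
  next
    case (add a b)
    then obtain s t r s' t' r' where
      str: "s \<in> ?S" "t \<in> ?S" "r \<in> ?S" "a = s + xbar * t + ybar * r"
      "s' \<in> ?S" "t' \<in> ?S" "r' \<in> ?S" "b = s' + xbar * t' + ybar * r'"
      unfolding Q_def by blast
    show ?case
      by (rule QI[OF Sadd[OF str(1,5)] Sadd[OF str(2,6)] Sadd[OF str(3,7)]])
        (simp add: str(4,8) algebra_simps)
  next
    case (x a)
    then obtain s t r where
      str: "s \<in> ?S" "t \<in> ?S" "r \<in> ?S" "a = s + xbar * t + ybar * r"
      unfolding Q_def by blast
    show ?case
      by (rule QI[OF Sadd[OF Smult[OF gens(2) str(2)] Smult[OF gens(3) str(3)]] str(1) zero])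
        (simp add: str(4) algebra_simps ubar_def vbar_def power2_eq_square)
  next
    case (y a)
    then obtain s t r where
      str: "s \<in> ?S" "t \<in> ?S" "r \<in> ?S" "a = s + xbar * t + ybar * r"
      unfolding Q_def by blast
    have "ybar * a = (vbar * t + (ubar * wbar + const (-1)) * r) + xbar * 0 + ybar * s"
      unfolding str(4) y2[symmetric] by (simp add: algebra_simps vbar_def)
    then show ?case
      by (rule QI[OF Sadd[OF Smult[OF gens(3) str(2)]
          Smult[OF Sadd[OF Smult[OF gens(2,4)] gens(1)[of "-1"]] str(3)]] zero str(1)])
  next
    case (z a)
    then obtain s t r where
      str: "s \<in> ?S" "t \<in> ?S" "r \<in> ?S" "a = s + xbar * t + ybar * r"
      unfolding Q_def by blast
    show ?case
      by (rule QI[OF Smult[OF gens(4) str(1)] Smult[OF gens(4) str(2)] Smult[OF gens(4) str(3)]])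
        (simp add: str(4) algebra_simps wbar_def)
  qed
  fix a :: "'k surface"
  assume a: "a \<in> B_ring"
  obtain s t r where
    str: "s \<in> ?S" "t \<in> ?S" "r \<in> ?S" "a = s + xbar * t + ybar * r" using decomp[of a] unfolding Q_def by blast
  then have sa: "sigma a = s - xbar * t - ybar * r"
    by (simp add: B_ring_def sigma_add sigma_mult sigma_gens)
  have "a + a = sigma a + a" using a by (simp add: B_ring_def)
  also have "\<dots> = s + s" unfolding sa by (subst str(4)) simp
  finally have "a + a = s + s" .
  moreover have half: "const (1/2) * (b + b) = b" for b :: "'k surface"
  proof -
    have "const (1/2) * (b + b) = const (1/2 + 1/2) * b"
      unfolding const_add by (simp add: algebra_simps)
    then show ?thesis by (simp add: const_1)
  qed
  ultimately have "a = s" by (metis half)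
  then show "a \<in> S" using str(1) by blast
qed

section \<open>The derivation of the invariant ring\<close>

text \<open>
  A derivation of the invariant ring is determined by its values on \<open>u\<close>, \<open>v\<close>, \<open>w\<close>. That the
  prescribed values do define one, so that the description below is proper, is lemma
  \<open>is_calD_calD\<close>.
\<close>

definition is_calD :: "('k::field surface \<Rightarrow> 'k surface) \<Rightarrow> bool" where
  "is_calD d \<longleftrightarrow> d \<in> Der B_ring \<and>
     d wbar = 1 \<and>
     d ubar = vbar + ubar ^ 2 * wbar - ubar - ubar ^ 2 \<and>
     d vbar = ubar * vbar * wbar - ubar * vbar + ubar * wbar - const (1/2) * (vbar + 1)"

definition calD :: "'k::field surface \<Rightarrow> 'k surface" where
  "calD = (THE d. is_calD d)"

lemma is_calD_unique:
  fixes d e :: "'k::field_char_0 surface \<Rightarrow> 'k surface"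
  assumes d: "is_calD d" and e: "is_calD e"
  shows "d = e"
proof
  have const: "f (const c) = 0" if "f \<in> Der B_ring" for f :: "'k surface \<Rightarrow> 'k surface" and c
  proof -
    have "const 1 \<in> (B_ring :: 'k surface set)" by (rule B_ring_closed)
    then have B1: "1 \<in> (B_ring :: 'k surface set)" by (simp add: const_1)
    then have "f (1 * 1) = f 1 * 1 + 1 * f 1" using that by (simp add: Der_def del: mult_1 mult_1_right)
    then have "f 1 = 0" by simp
    moreover have "f (const c * 1) = const c * f 1" using that B1 by (simp add: Der_def del: mult_1_right)
    ultimately show ?thesis by simp
  qed
  have dD: "d \<in> Der B_ring" and eD: "e \<in> Der B_ring" using d e by (simp_all add: is_calD_def)
  have "B_ring \<subseteq> {a \<in> B_ring. d a = e a}"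
    by (rule B_ring_generated)
      (use d e in \<open>auto simp: const[OF dD] const[OF eD] B_ring_closed is_calD_def Der_def\<close>)
  moreover fix a
  have "d a = e a" if "a \<notin> B_ring"
    using that dD eD by (simp add: Der_def PiE_def extensional_def)
  ultimately show "d a = e a" by blast
qed

text \<open>
  Existence: the derivation is the restriction of the derivation of \<open>A\<close> with
  \<open>2 D(x) = y + x\<^sup>3z - x - x\<^sup>3\<close>, \<open>2 D(y) = x\<^sup>2yz - x\<^sup>2y + xz\<close> and \<open>D(z) = 1\<close>.
\<close>

definition plift :: "'k::field poly poly poly \<Rightarrow> 'k poly poly poly" where
  "plift p =
     pC (1/2) * (pY + pX ^ 3 * pZ - pX - pX ^ 3) * map_poly (map_poly pderiv) p +
     pC (1/2) * (pX ^ 2 * pY * pZ - pX ^ 2 * pY + pX * pZ) * pderiv p +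
     map_poly pderiv p"

lemma plift_add: "plift (p + q) = plift p + plift q"
  by (simp add: plift_def map_poly_additive pderiv_add algebra_simps)

lemma map_pderiv_mult:
  fixes a b :: "'a::idom poly poly"
  shows "map_poly pderiv (a * b) = map_poly pderiv a * b + a * map_poly pderiv b"
  by (rule map_poly_leibniz) (simp_all add: pderiv_add pderiv_mult mult.commute)

lemma plift_mult: "plift (p * q) = plift p * q + p * plift q"
proof -
  have 1: "map_poly (map_poly pderiv) (p * q) =
      map_poly (map_poly pderiv) p * q + p * map_poly (map_poly pderiv) q"
    by (rule map_poly_leibniz) (simp_all add: map_poly_additive pderiv_add map_pderiv_mult)
  note 2 = map_pderiv_mult[of p q]
  show ?thesis unfolding plift_def 1 2 pderiv_mult by (simp add: algebra_simps)
qed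

lemma plift_gens:
  "plift (pX :: 'k::field poly poly poly) = pC (1/2) * (pY + pX ^ 3 * pZ - pX - pX ^ 3)"
  "plift (pY :: 'k poly poly poly) = pC (1/2) * (pX ^ 2 * pY * pZ - pX ^ 2 * pY + pX * pZ)"
  "plift (pZ :: 'k poly poly poly) = 1" "plift (pC (c :: 'k)) = 0"
proof -
  have e: "map_poly (map_poly pderiv) pX = (1 :: 'k poly poly poly)" "pderiv pX = (0 :: 'k poly poly poly)"
    "map_poly pderiv pX = (0 :: 'k poly poly poly)"
    "map_poly (map_poly pderiv) pY = (0 :: 'k poly poly poly)" "pderiv pY = (1 :: 'k poly poly poly)"
    "map_poly pderiv pY = (0 :: 'k poly poly poly)"
    "map_poly (map_poly pderiv) pZ = (0 :: 'k poly poly poly)" "pderiv pZ = (0 :: 'k poly poly poly)"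
    "map_poly pderiv pZ = (1 :: 'k poly poly poly)"
    by (simp_all add: pX_def pY_def pZ_def map_poly_pCons pderiv_pCons one_pCons)
  show "plift pX = pC (1/2) * (pY + pX ^ 3 * pZ - pX - (pX :: 'k poly poly poly) ^ 3)"
    "plift pY = pC (1/2) * (pX ^ 2 * pY * pZ - pX ^ 2 * pY + pX * (pZ :: 'k poly poly poly))"
    "plift pZ = (1 :: 'k poly poly poly)"
    unfolding plift_def e by simp_all
  show "plift (pC c) = 0"
    by (simp add: plift_def pC_def map_poly_pCons pderiv_pCons)
qed

lemma pC_half: "pC (1/2) + pC (1/2) = (1 :: 'k::field_char_0 poly poly poly)"
  by (simp add: pC_def one_pCons)

lemma plift_surface_poly:
  "plift surface_poly = (pX ^ 2 * pZ - pX ^ 2) * (surface_poly :: 'k::field_char_0 poly poly poly)"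
proof -
  have m1: "plift (-1) = (0 :: 'k poly poly poly)"
    using plift_gens(4)[of "-1"] by (simp add: pC_def one_pCons)
  have eq: "surface_poly = pX * pX * pZ + (-1) * (pY * pY) + (-1 :: 'k poly poly poly)"
    by (simp add: surface_poly_def power2_eq_square)
  let ?h = "pC (1/2) :: 'k poly poly poly"
  have "plift surface_poly =
     (?h + ?h) * (pX * pZ * (pY + pX ^ 3 * pZ - pX - pX ^ 3)
       - pY * (pX ^ 2 * pY * pZ - pX ^ 2 * pY + pX * pZ)) + pX ^ 2"
    unfolding eq plift_add plift_mult plift_gens m1
    by (simp add: algebra_simps power2_eq_square power3_eq_cube)
  also have "\<dots> = (pX ^ 2 * pZ - pX ^ 2) * surface_poly"
    unfolding pC_half surface_poly_def
    by (simp add: algebra_simps power2_eq_square power3_eq_cube)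
  finally show ?thesis .
qed

lemma is_calD_exists: "\<exists>d :: 'k::field_char_0 surface \<Rightarrow> 'k surface. is_calD d"
proof -
  define D :: "'k surface \<Rightarrow> 'k surface" where "D a = abs_surface (plift (rep_surface a))" for a
  have rel: "surface_rel (plift p) (plift q)" if pq: "surface_rel p q" for p q :: "'k poly poly poly"
  proof -
    obtain r where "p = q + surface_poly * r"
      using pq by (auto simp: surface_rel_def dvd_def algebra_simps)
    then have "plift p - plift q = surface_poly * ((pX ^ 2 * pZ - pX ^ 2) * r + plift r)"
      by (simp add: plift_add plift_mult plift_surface_poly algebra_simps)
    then show ?thesis by (simp add: surface_rel_def)
  qed
  have D_abs: "D (abs_surface p) = abs_surface (plift p)" for p
    unfolding D_def
    by (intro surface.abs_eq_iff[THEN iffD2] rel)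
      (metis Quotient_surface Quotient_rep_abs equivp_reflp surface_rel_equivp)
  have D_add: "D (a + b) = D a + D b" for a b
    by (induction a rule: surface.abs_induct, induction b rule: surface.abs_induct)
      (simp add: D_abs plus_surface.abs_eq plift_add)
  have D_mult: "D (a * b) = D a * b + a * D b" for a b
    by (induction a rule: surface.abs_induct, induction b rule: surface.abs_induct)
      (simp add: D_abs plus_surface.abs_eq times_surface.abs_eq plift_mult)
  have D_const: "D (const c) = 0" for c
    by (simp add: const.abs_eq D_abs plift_gens zero_surface_def)
  note abs = const.abs_eq xbar_def ybar_def zbar_def plus_surface.abs_eq times_surface.abs_eq
    minus_surface.abs_eq one_surface_def
  have D_x: "D xbar = const (1/2) * (ybar + xbar ^ 3 * zbar - xbar - xbar ^ 3)"
    unfolding power3_eq_cube by (simp add: abs D_abs plift_gens power3_eq_cube)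
  have D_y: "D ybar = const (1/2) * (xbar ^ 2 * ybar * zbar - xbar ^ 2 * ybar + xbar * zbar)"
    unfolding power2_eq_square by (simp add: abs D_abs plift_gens power2_eq_square)
  have D_z: "D zbar = 1"
    by (simp add: abs D_abs plift_gens)
  have D_sigma: "sigma (D a) = D (sigma a)" for a
  proof -
    have D_uminus: "D (- a) = - D a" for a
      using D_mult[of "const (-1)" a] unfolding D_const by (simp add: const_uminus const_1)
    show ?thesis
      by (induction a rule: surface_induct)
        (simp_all add: sigma_add sigma_mult sigma_gens sigma_diff sigma_uminus D_add D_mult
          D_const D_x D_y D_z D_uminus power2_eq_square power3_eq_cube algebra_simps
          sigma_gens(4)[of 0, unfolded const_0] sigma_gens(4)[of 1, unfolded const_1])
  qed
  let ?h = "const (1/2) :: 'k surface"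
  have half: "?h + ?h = 1"
    by (simp add: const_add[symmetric] const_1)
  let ?d = "restrict D B_ring"
  have B1: "1 \<in> (B_ring :: 'k surface set)"
    using B_ring_closed(1)[of 1] by (simp add: const_1)
  have "?d \<in> Der B_ring"
    unfolding Der_def
    by (auto simp: B_ring_closed D_add D_mult D_const PiE_def)
      (simp add: B_ring_def D_sigma)
  moreover have "D wbar = 1" by (simp add: wbar_def D_z)
  moreover have "D ubar = vbar + ubar ^ 2 * wbar - ubar - ubar ^ 2"
  proof -
    have "D ubar = (?h + ?h) * (xbar * (ybar + xbar ^ 3 * zbar - xbar - xbar ^ 3))"
      by (simp add: ubar_def power2_eq_square D_mult D_x algebra_simps)
    then show ?thesis unfolding half
      by (simp add: ubar_def vbar_def wbar_def algebra_simps power2_eq_square power3_eq_cube)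
  qed
  moreover have "D vbar = ubar * vbar * wbar - ubar * vbar + ubar * wbar - ?h * (vbar + 1)"
  proof -
    have "D vbar = ?h * (ybar ^ 2) + ?h * (xbar ^ 2 * zbar) - ?h * vbar
      + (?h + ?h) * (ubar * vbar * wbar - ubar * vbar)"
      by (simp add: vbar_def ubar_def wbar_def D_mult D_x D_y algebra_simps power2_eq_square
          power3_eq_cube)
    also have "\<dots> = (?h + ?h) * (ubar * wbar) - ?h * (vbar + 1)
      + (?h + ?h) * (ubar * vbar * wbar - ubar * vbar)"
      unfolding ybar_squared by (simp add: ubar_def wbar_def algebra_simps)
    finally show ?thesis unfolding half by simp
  qed
  ultimately have "is_calD ?d" by (simp add: is_calD_def B_ring_closed)
  then show ?thesis by blast
qed

lemma is_calD_calD: "is_calD (calD :: 'k::field_char_0 surface \<Rightarrow> 'k surface)"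
  unfolding calD_def using is_calD_exists is_calD_unique by (metis theI)

end

theory Submission
  imports Defs
begin

text \<open>
  The derivation is the lift of \<open>calD\<close> to \<open>A\<close> given by
  \<open>2 D(x) = y + x\<^sup>3z - x - x\<^sup>3\<close>, \<open>2 D(y) = x\<^sup>2yz - x\<^sup>2y + xz\<close>, \<open>D(z) = 1\<close>; it visibly commutes with
  \<open>\<sigma>\<close>, and the whole difficulty is its simplicity.

  After inverting \<open>x\<close>, put \<open>s = y/x - 1/2\<close>. Then \<open>1/x\<^sup>2 = z - (y/x)\<^sup>2\<close> lies in \<open>k[z,s]\<close>, and \<open>D\<close>
  restricts to \<open>k[z,s]\<close> as
  \<open>D(z) = 1\<close>, \<open>D(s) = (z + 1/4 - s\<^sup>2)/2\<close>,
  the Riccati equation attached to the Airy equation. A proper nonzero ideal of \<open>k[z,s]\<close> stable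
  under this derivation \<open>d\<close> would give a polynomial \<open>F\<close> of positive degree in \<open>s\<close> with
  \<open>F\<close> dividing \<open>d F\<close>. There is none (\<open>airy_no_darboux\<close>): if \<open>d F = G F\<close> then
  \<open>G = \<beta>(z) - (m/2) s\<close> with \<open>m\<close> the degree of \<open>F\<close> in \<open>s\<close>, and the coefficients of \<open>F\<close>, read from the
  top one down, satisfy a three-term recurrence that has to terminate after \<open>m + 1\<close> steps. Comparing
  highest powers of \<open>z\<close> shows that it does not terminate: the leading terms are either governed by
  \<open>\<beta>\<close>, or products of positive rationals that cannot cancel. Hence \<open>d\<close> is simple
  (\<open>airy_simple\<close>).

  To return to \<open>A\<close> without localising, \<open>f(z,s)\<close> is replaced by its homogenisation
  \<open>x\<^sup>N f(z, y/x - 1/2)\<close>, an element of \<open>A\<close> once \<open>N\<close> is at least the degree of \<open>f\<close> in \<open>s\<close>. For a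
  \<open>D\<close>-stable ideal \<open>I\<close>, the \<open>f\<close> with a homogenisation in \<open>I\<close> form a \<open>d\<close>-stable ideal of
  \<open>k[z,s]\<close>, nonzero if \<open>I\<close> is, since norms produce nonzero polynomials in \<open>z\<close> and \<open>x\<^sup>2\<close> inside \<open>I\<close>.
  So \<open>I\<close> contains a power of \<open>x\<close> (\<open>ideal_power_x\<close>). As \<open>D(x)\<close> is \<open>y/2\<close> modulo \<open>x\<close> and \<open>y\<^sup>2 = -1\<close>
  modulo \<open>x\<close>, the exponent can be lowered to \<open>0\<close> (\<open>lower_power_x\<close>), so \<open>I = A\<close>.
\<close>

section \<open>The coefficient recurrence of the Airy--Riccati equation\<close>

text \<open>
  The term \<open>\<beta> c\<^sub>j\<close> raises the degree by \<open>deg \<beta> \<ge> 1\<close> at each step. Both competitors have smaller degree: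
  differentiation lowers it, and multiplication by \<open>z + 1/4\<close> adds one to a degree that is
  \<open>deg \<beta>\<close> lower, while \<open>2 deg \<beta> > 1\<close>.
\<close>
lemma airy_recurrence_nonconst:
  fixes c :: "nat \<Rightarrow> 'k::field_char_0 poly"
  assumes rec: "\<And>j. j \<le> m \<Longrightarrow> smult (of_nat (Suc j)) (c (Suc j)) =
      smult 2 (\<beta> * c j) - smult 2 (pderiv (c j))
      - (if j = 0 then 0 else smult (of_nat (Suc m - j)) ([:1/4, 1:] * c (j - 1)))"
    and c0: "c 0 \<noteq> 0" and \<beta>: "degree \<beta> > 0"
  shows "c (Suc m) \<noteq> 0"
proof -
  let ?deg = "\<lambda>j. c j \<noteq> 0 \<and> degree (c j) = degree (c 0) + j * degree \<beta>"
  have \<beta>0: "\<beta> \<noteq> 0" using \<beta> by auto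
  have step: "?deg (Suc j)" if j: "j \<le> m" "?deg j" "j > 0 \<Longrightarrow> ?deg (j - 1)" for j
  proof -
    let ?q = "- smult 2 (pderiv (c j))
      - (if j = 0 then 0 else smult (of_nat (Suc m - j)) ([:1/4, 1:] * c (j - 1)))"
    have top: "degree (smult 2 (\<beta> * c j)) = degree (c 0) + Suc j * degree \<beta>"
      using j(2) \<beta>0 by (simp add: degree_mult_eq)
    have "degree (pderiv (c j)) < degree (c 0) + Suc j * degree \<beta>"
      using j(2) \<beta> by (simp add: degree_pderiv)
    moreover have "degree ([:1/4, 1:] * c (j - 1)) < degree (c 0) + Suc j * degree \<beta>" if "j > 0"
    proof -
      obtain i where i: "j = Suc i" using \<open>j > 0\<close> by (cases j) auto
      have "degree ([:1/4, 1:] * c i) = Suc (degree (c 0) + i * degree \<beta>)"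
        using j(3) i by (subst degree_mult_eq) auto
      then show ?thesis using \<beta> by (simp add: i)
    qed
    ultimately have low: "degree ?q < degree (smult 2 (\<beta> * c j))"
      unfolding top by (intro degree_diff_less) (auto intro: le_less_trans[OF degree_smult_le])
    have eq: "smult (of_nat (Suc j)) (c (Suc j)) = smult 2 (\<beta> * c j) + ?q"
      using rec[OF j(1)] by simp
    have "degree (smult (of_nat (Suc j)) (c (Suc j))) = degree (c 0) + Suc j * degree \<beta>"
      unfolding eq using degree_add_eq_left[OF low] top by simp
    then show ?thesis using \<beta> by (auto simp del: of_nat_Suc)
  qed
  have "j \<le> m \<Longrightarrow> ?deg j \<and> ?deg (Suc j)" for j
  proof (induction j)
    case 0
    then show ?case using step[of 0] c0 by simp
  next
    case (Suc j)
    then show ?case using step[of "Suc j"] by simp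
  qed
  then show ?thesis by blast
qed

text \<open>
  In an arbitrary field of characteristic zero, the image of the positive rationals is the
  substitute for positivity: sums of its elements cannot vanish.
\<close>
definition pos_rats :: "'k::field_char_0 set" where
  "pos_rats = of_rat ` {0<..}"

lemma pos_rats_closed:
  fixes x y :: "'k::field_char_0"
  shows
  "x \<in> pos_rats \<Longrightarrow> y \<in> pos_rats \<Longrightarrow> x + y \<in> pos_rats"
  "x \<in> pos_rats \<Longrightarrow> y \<in> pos_rats \<Longrightarrow> x * y \<in> pos_rats"
  "x \<in> pos_rats \<Longrightarrow> y \<in> pos_rats \<Longrightarrow> x / y \<in> pos_rats"
  "n > 0 \<Longrightarrow> of_nat n \<in> (pos_rats :: 'k set)"
  "numeral k \<in> (pos_rats :: 'k set)"
proof -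
  show "x + y \<in> pos_rats" "x * y \<in> pos_rats" "x / y \<in> pos_rats"
    if xy: "x \<in> pos_rats" "y \<in> pos_rats"
  proof -
    obtain r s where rs: "x = of_rat r" "r > 0" "y = of_rat s" "s > 0"
      using xy by (auto simp: pos_rats_def)
    have "x + y = of_rat (r + s)" "x * y = of_rat (r * s)" "x / y = of_rat (r / s)"
      by (simp_all add: rs of_rat_add of_rat_mult of_rat_divide)
    moreover have "r + s \<in> {0<..}" "r * s \<in> {0<..}" "r / s \<in> {0<..}" using rs by simp_all
    ultimately show "x + y \<in> pos_rats" "x * y \<in> pos_rats" "x / y \<in> pos_rats"
      unfolding pos_rats_def by blast+
  qed
  show "of_nat n \<in> (pos_rats :: 'k set)" if "n > 0"
    unfolding pos_rats_def using that by (intro image_eqI[of _ _ "of_nat n"]) auto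
  show "numeral k \<in> (pos_rats :: 'k set)"
    unfolding pos_rats_def by (intro image_eqI[of _ _ "numeral k"]) auto
qed

lemma pos_rats_nonzero: "x \<in> pos_rats \<Longrightarrow> x \<noteq> 0"
  by (auto simp: pos_rats_def)

text \<open>
  For constant \<open>\<beta> = b\<close> the dominant term is the factor \<open>z\<close>, which acts every second step. With \<open>e\<close> the
  degree and \<open>\<lambda>\<close> the leading coefficient of \<open>c\<^sub>0\<close>, the polynomial \<open>c\<^bsub>2l\<^esub>\<close> has leading term
  \<open>\<lambda>(-1)\<^sup>l r z\<^bsup>e+l\<^esup>\<close> with \<open>r\<close> a positive rational. In \<open>c\<^bsub>2l+1\<^esub>\<close> exactly one step is not multiplication by
  \<open>z\<close>; it contributes \<open>b\<close> or a derivative. All contributions containing \<open>b\<close> have the same sign, so the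
  coefficient of \<open>z\<^bsup>e+l\<^esup>\<close> is \<open>b \<lambda>(-1)\<^sup>l\<close> times a positive rational; if \<open>b = 0\<close>, the coefficient
  of \<open>z\<^bsup>e+l-1\<^esup>\<close> is \<open>-\<lambda>(-1)\<^sup>l\<close> times a positive rational, by the same argument for derivatives. Hence no term vanishes, except possibly \<open>c\<^sub>1\<close> when
  \<open>b = e = 0\<close>, which the hypothesis \<open>m > 0\<close> keeps away from the last step.
\<close>
lemma airy_recurrence_const:
  fixes c :: "nat \<Rightarrow> 'k::field_char_0 poly"
  assumes rec: "\<And>j. j \<le> m \<Longrightarrow> smult (of_nat (Suc j)) (c (Suc j)) =
      smult (2 * b) (c j) - smult 2 (pderiv (c j))
      - (if j = 0 then 0 else smult (of_nat (Suc m - j)) ([:1/4, 1:] * c (j - 1)))"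
    and c0: "c 0 \<noteq> 0" and m: "m > 0"
  shows "c (Suc m) \<noteq> 0"
proof -
  define e where "e = degree (c 0)"
  define s where "s l = lead_coeff (c 0) * (-1) ^ l" for l :: nat
  have s: "s l \<noteq> 0" "s (Suc l) = - s l" for l
    using c0 by (simp_all add: s_def)
  have rec_coeff: "of_nat (Suc j) * coeff (c (Suc j)) n =
      2 * b * coeff (c j) n - 2 * of_nat (Suc n) * coeff (c j) (Suc n)
      - (if j = 0 then 0 else of_nat (Suc m - j) *
          (1/4 * coeff (c (j - 1)) n + (if n = 0 then 0 else coeff (c (j - 1)) (n - 1))))"
    if "j \<le> m" for j n
    using arg_cong[OF rec[OF that], of "\<lambda>p. coeff p n"]
    by (cases n) (simp_all add: coeff_pderiv split: if_splits del: of_nat_Suc)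
  define even_ok where "even_ok l \<longleftrightarrow> (\<forall>n > e + l. coeff (c (2 * l)) n = 0) \<and>
      coeff (c (2 * l)) (e + l) / s l \<in> pos_rats" for l
  \<comment> \<open>The form \<open>Suc n = e + l\<close> avoids the truncated difference \<open>e + l - 1\<close> when \<open>e = l = 0\<close>.\<close>
  define odd_ok where "odd_ok l \<longleftrightarrow> (\<forall>n > e + l. coeff (c (Suc (2 * l))) n = 0) \<and>
      (\<exists>r \<in> pos_rats. coeff (c (Suc (2 * l))) (e + l) = b * s l * r) \<and>
      (b = 0 \<longrightarrow> (\<forall>n. Suc n = e + l \<longrightarrow>
        - coeff (c (Suc (2 * l))) n / s l \<in> pos_rats))" for l
  have even0: "even_ok 0"
    using c0 pos_rats_closed(4)[of 1, where ?'k = 'k]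
    by (simp add: even_ok_def e_def s_def coeff_eq_0)
  have odd_step: "odd_ok l"
    if l: "2 * l \<le> m" and ev: "even_ok l" and od: "l > 0 \<Longrightarrow> odd_ok (l - 1)" for l
  proof -
    let ?N = "of_nat (Suc (2 * l)) :: 'k"
    have N: "?N \<in> pos_rats" by (rule pos_rats_closed) simp
    have evz: "coeff (c (2 * l)) n = 0" if "n > e + l" for n using ev that by (simp add: even_ok_def)
    define r where "r = coeff (c (2 * l)) (e + l) / s l"
    have r: "r \<in> pos_rats" "coeff (c (2 * l)) (e + l) = s l * r"
      using ev s by (simp_all add: even_ok_def r_def)
    have R: "?N * coeff (c (Suc (2 * l))) n =
      2 * b * coeff (c (2 * l)) n - 2 * of_nat (Suc n) * coeff (c (2 * l)) (Suc n)
      - (if l = 0 then 0 else of_nat (Suc m - 2 * l) *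
          (1/4 * coeff (c (2 * l - 1)) n + (if n = 0 then 0 else coeff (c (2 * l - 1)) (n - 1))))" for n
      using rec_coeff[OF l, of n] by simp
    show ?thesis
    proof (cases l)
      case 0
      have "coeff (c (Suc (2 * l))) n = 0" if "n > e + l" for n
        using R[of n] that 0 evz[of n] evz[of "Suc n"] N by (simp add: pos_rats_nonzero)
      moreover have "coeff (c (Suc (2 * l))) (e + l) = b * s l * (2 * r)"
        using R[of "e + l"] 0 evz[of "Suc (e + l)"] r by simp
      moreover have "2 * r \<in> pos_rats" by (intro pos_rats_closed r)
      moreover have "- coeff (c (Suc (2 * l))) n / s l \<in> pos_rats" if "b = 0" "Suc n = e + l" for n
      proof -
        have "- coeff (c (Suc (2 * l))) n / s l = 2 * of_nat (Suc n) * r"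
          using R[of n] 0 r that s(1)[of l] by (simp add: field_simps)
        also have "\<dots> \<in> pos_rats" by (intro pos_rats_closed r) simp
        finally show ?thesis .
      qed
      ultimately show ?thesis unfolding odd_ok_def by blast
    next
      case (Suc i)
      let ?M = "of_nat (Suc m - 2 * l) :: 'k"
      have M: "?M \<in> pos_rats" by (rule pos_rats_closed) (use l in simp)
      have od: "odd_ok i" using od Suc by simp
      have odz: "coeff (c (Suc (2 * i))) n = 0" if "n > e + i" for n using od that by (simp add: odd_ok_def)
      obtain r' where r': "r' \<in> pos_rats" "coeff (c (Suc (2 * i))) (e + i) = b * s i * r'"
        using od by (auto simp: odd_ok_def)
      have R: "?N * coeff (c (Suc (2 * l))) n =
        2 * b * coeff (c (2 * l)) n - 2 * of_nat (Suc n) * coeff (c (2 * l)) (Suc n)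
        - ?M * (1/4 * coeff (c (Suc (2 * i))) n + (if n = 0 then 0 else coeff (c (Suc (2 * i))) (n - 1)))" for n
        using R[of n] Suc by simp
      have "coeff (c (Suc (2 * l))) n = 0" if "n > e + l" for n
        using R[of n] that Suc evz[of n] evz[of "Suc n"] odz[of n] odz[of "n - 1"] N
        by (simp add: pos_rats_nonzero del: of_nat_Suc)
      moreover have "coeff (c (Suc (2 * l))) (e + l) = b * s l * ((2 * r + ?M * r') / ?N)"
      proof -
        have "?N * coeff (c (Suc (2 * l))) (e + l) = b * s l * (2 * r + ?M * r')"
          using R[of "e + l"] evz[of "Suc (e + l)"] odz[of "e + l"] r r' Suc s(2)[of i]
          by (simp add: algebra_simps del: of_nat_Suc)
        then show ?thesis using pos_rats_nonzero[OF N] by (simp add: field_simps del: of_nat_Suc)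
      qed
      moreover have "(2 * r + ?M * r') / ?N \<in> pos_rats" by (intro pos_rats_closed r r' N M) 
      moreover have "- coeff (c (Suc (2 * l))) n / s l \<in> pos_rats" if b: "b = 0" and n: "Suc n = e + l" for n
      proof -
        have n': "n = e + i" using n Suc by simp
        have z: "coeff (c (Suc (2 * i))) n = 0" using r' b n' by simp
        define t where "t = (if n = 0 then 0 else coeff (c (Suc (2 * i))) (n - 1))"
        have t: "2 * of_nat (Suc n) * r + ?M * (t / s l) \<in> pos_rats"
        proof (cases n)
          case 0
          have "2 * of_nat (Suc n) * r \<in> pos_rats" by (intro pos_rats_closed r) simp
          then show ?thesis using 0 by (simp add: t_def)
        next
          case (Suc k)
          then have "- coeff (c (Suc (2 * i))) k / s i \<in> pos_rats"
            using od b n' by (simp add: odd_ok_def)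
          then have "t / s l \<in> pos_rats"
            using Suc \<open>l = Suc i\<close> by (simp add: t_def s)
          moreover have "2 * of_nat (Suc n) * r \<in> pos_rats" by (intro pos_rats_closed r) simp
          ultimately show ?thesis
            by (intro pos_rats_closed(1) pos_rats_closed(2)[OF M])
        qed
        have "?N * coeff (c (Suc (2 * l))) n = - (2 * of_nat (Suc n) * (s l * r)) - ?M * t"
          using R[of n] r(2) unfolding b z t_def[symmetric] n by (simp del: of_nat_Suc)
        moreover have "s l * (2 * of_nat (Suc n) * r + ?M * (t / s l))
            = 2 * of_nat (Suc n) * (s l * r) + ?M * t"
          using s(1)[of l] by (simp add: field_simps)
        ultimately have "?N * (- coeff (c (Suc (2 * l))) n)
            = s l * (2 * of_nat (Suc n) * r + ?M * (t / s l))"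
          by (simp del: of_nat_Suc)
        then have "- coeff (c (Suc (2 * l))) n / s l = (2 * of_nat (Suc n) * r + ?M * (t / s l)) / ?N"
          unfolding frac_eq_eq[OF s(1) pos_rats_nonzero[OF N]] by (simp only: mult.commute)
        also have "\<dots> \<in> pos_rats" using t N by (rule pos_rats_closed)
        finally show ?thesis .
      qed
      ultimately show ?thesis unfolding odd_ok_def by blast
    qed
  qed
  have even_step: "even_ok (Suc l)" if l: "Suc (2 * l) \<le> m" and ev: "even_ok l" and od: "odd_ok l" for l
  proof -
    let ?N = "of_nat (Suc (Suc (2 * l))) :: 'k"
    let ?M = "of_nat (m - 2 * l) :: 'k"
    have N: "?N \<in> pos_rats" and M: "?M \<in> pos_rats" 
      by (rule pos_rats_closed; use l in simp)+
    have evz: "coeff (c (2 * l)) n = 0" if "n > e + l" for n using ev that by (simp add: even_ok_def)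
    have odz: "coeff (c (Suc (2 * l))) n = 0" if "n > e + l" for n using od that by (simp add: odd_ok_def)
    have R: "?N * coeff (c (2 * Suc l)) (Suc n) = - ?M * coeff (c (2 * l)) n" if "n \<ge> e + l" for n
      using rec_coeff[OF l, of "Suc n"] that evz[of "Suc n"] odz[of "Suc n"] odz[of "Suc (Suc n)"]
      by (simp del: of_nat_Suc)
    have "coeff (c (2 * Suc l)) n = 0" if "n > e + Suc l" for n
      using R[of "n - 1"] that evz[of "n - 1"] pos_rats_nonzero[OF N] by (simp del: of_nat_Suc)
    moreover have "coeff (c (2 * Suc l)) (e + Suc l) / s (Suc l)
        = ?M * (coeff (c (2 * l)) (e + l) / s l) / ?N"
      using R[of "e + l"] pos_rats_nonzero[OF N] s[of l] by (simp add: field_simps del: of_nat_Suc)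
    moreover have "?M * (coeff (c (2 * l)) (e + l) / s l) / ?N \<in> pos_rats"
      by (intro pos_rats_closed(3)[OF pos_rats_closed(2)[OF M] N])
        (use ev in \<open>simp add: even_ok_def\<close>)
    ultimately show ?thesis unfolding even_ok_def by simp
  qed
  have all: "(2 * l \<le> Suc m \<longrightarrow> even_ok l) \<and> (2 * l \<le> m \<longrightarrow> odd_ok l)" for l
  proof (induction l)
    case 0
    then show ?case using even0 odd_step[of 0] by simp
  next
    case (Suc l)
    then show ?case using even_step[of l] odd_step[of "Suc l"] by simp
  qed
  show ?thesis
  proof (cases "even m")
    case False
    then obtain l where l: "Suc m = 2 * l" by (metis evenE even_Suc)
    then have "coeff (c (Suc m)) (e + l) / s l \<in> pos_rats" using all[of l] by (simp add: even_ok_def)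
    then show ?thesis using pos_rats_nonzero by force
  next
    case True
    then obtain l where l: "m = 2 * l" by (elim evenE)
    then have od: "odd_ok l" using all[of l] by simp
    show ?thesis
    proof (cases "b = 0")
      case False
      then have "coeff (c (Suc m)) (e + l) \<noteq> 0"
        using od l s(1)[of l] by (auto simp: odd_ok_def pos_rats_nonzero)
      then show ?thesis by auto
    next
      case True
      obtain n where "Suc n = e + l" using l m by (cases "e + l") auto
      then have "- coeff (c (Suc m)) n / s l \<in> pos_rats"
        using od True l by (simp add: odd_ok_def)
      then show ?thesis using pos_rats_nonzero by force
    qed
  qed
qed

section \<open>Simplicity of the Airy--Riccati derivation of \<open>k[z,s]\<close>\<close>

text \<open>
  The ring \<open>k[z,s]\<close> is represented as \<open>k[z][s]\<close>, the outer variable being \<open>s\<close>; \<open>airy_drift\<close> is the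
  value \<open>(z + 1/4 - s\<^sup>2)/2\<close> of the derivation at \<open>s\<close>.
\<close>

definition airy_drift :: "'k::field_char_0 poly poly" where
  "airy_drift = [:[:1/8, 1/2:], 0, [:-1/2:]:]"

definition airy_der :: "'k::field_char_0 poly poly \<Rightarrow> 'k poly poly" where
  "airy_der f = map_poly pderiv f + airy_drift * pderiv f"

lemma airy_der_pCons:
  "airy_der (pCons c f) = [:pderiv c:] + airy_drift * f + pCons 0 (airy_der f)"
  by (simp add: airy_der_def map_poly_pCons pderiv_pCons algebra_simps)

lemma airy_der_const: "airy_der [:c:] = [:pderiv c:]"
  by (simp add: airy_der_def map_poly_pCons pderiv_pCons)

lemma airy_der_smult: "airy_der (smult c f) = smult (pderiv c) f + smult c (airy_der f)"
proof -
  have "map_poly pderiv (smult c f) = smult (pderiv c) f + smult c (map_poly pderiv f)"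
    by (rule poly_eqI) (simp add: coeff_map_poly pderiv_mult)
  then show ?thesis by (simp add: airy_der_def pderiv_smult algebra_simps smult_add_right)
qed

lemma coeff_airy_der:
  "coeff (airy_der f) i = pderiv (coeff f i)
     + smult (of_nat (Suc i) / 2) ([:1/4, 1:] * coeff f (Suc i))
     - (if i = 0 then 0 else smult (of_nat (i - 1) / 2) (coeff f (i - 1)))"
proof -
  have 1: "coeff (airy_drift * g) i = smult (1/2) ([:1/4, 1:] * coeff g i)
      - (if i < 2 then 0 else smult (1/2) (coeff g (i - 2)))" for g :: "'a poly poly"
    by (auto simp: airy_drift_def coeff_pCons smult_add_right numeral_2_eq_2 split: nat.split)
  have 2: "coeff (pderiv f) n = smult (of_nat (Suc n)) (coeff f (Suc n))" for n
    by (simp add: coeff_pderiv of_nat_poly del: of_nat_Suc)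
  show ?thesis
  proof (cases "i < 2")
    case True
    then have "i = 0 \<or> i = 1" by auto
    then show ?thesis
      by (auto simp: airy_der_def 1 2 coeff_map_poly smult_add_right simp del: of_nat_Suc)
  next
    case False
    then have "Suc (i - 2) = i - 1" "i \<noteq> 0" by auto
    then show ?thesis
      using False by (simp add: airy_der_def 1 2 coeff_map_poly del: of_nat_Suc)
  qed
qed

text \<open>
  The degree in \<open>s\<close> grows by exactly one under the derivation, which forces the cofactor \<open>G\<close> to be
  \<open>\<beta> - (m/2) s\<close>. The remaining coefficients of \<open>d F = G F\<close> form the recurrence above for
  \<open>c\<^sub>j\<close>, the coefficient of \<open>s\<^bsup>m-j\<^esup>\<close>; the coefficient of \<open>s\<^sup>0\<close> is the condition that
  it stops, \<open>c\<^bsub>m+1\<^esub> = 0\<close>.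
\<close>
lemma airy_no_darboux:
  assumes eq: "airy_der F = G * F" and F: "F \<noteq> 0"
  shows "degree F = 0"
proof (rule ccontr)
  assume nz: "degree F \<noteq> 0"
  define m where "m = degree F"
  have m: "m > 0" using nz by (simp add: m_def)
  have lc: "coeff F m \<noteq> 0" using F by (simp add: m_def)
  have top: "coeff (airy_der F) (Suc m) = smult (- of_nat m / 2) (coeff F m)"
    by (simp add: coeff_airy_der m_def coeff_eq_0)
  have "degree (airy_der F) = Suc m"
  proof (rule antisym)
    show "degree (airy_der F) \<le> Suc m"
      by (rule degree_le) (auto simp: coeff_airy_der m_def coeff_eq_0)
    show "Suc m \<le> degree (airy_der F)"
      by (rule le_degree) (use m lc in \<open>simp add: top\<close>)
  qed
  moreover have "G \<noteq> 0" using top eq lc m by auto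
  ultimately have "degree G = 1"
    using F unfolding eq by (simp add: degree_mult_eq m_def)
  then obtain \<beta> \<gamma> where G: "G = [:\<beta>, \<gamma>:]"
    by (metis One_nat_def degree_eq_zeroE degree_pCons_eq_if nat.distinct(1) nat.inject pCons_cases)
  have GF: "coeff (G * F) i = \<beta> * coeff F i + (if i = 0 then 0 else \<gamma> * coeff F (i - 1))" for i
    by (cases i) (simp_all add: G)
  have "(\<gamma> - [:- of_nat m / 2:]) * coeff F m = 0"
    using top unfolding eq GF by (simp add: m_def coeff_eq_0 algebra_simps)
  then have \<gamma>: "\<gamma> = [:- of_nat m / 2:]" using lc by simp
  define c where "c j = (if j \<le> m then coeff F (m - j) else 0)" for j
  have rec: "smult (of_nat (Suc j)) (c (Suc j)) =
      smult 2 (\<beta> * c j) - smult 2 (pderiv (c j))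
      - (if j = 0 then 0 else smult (of_nat (Suc m - j)) ([:1/4, 1:] * c (j - 1)))"
    if j: "j \<le> m" for j
  proof -
    define i where "i = m - j"
    have up: "coeff F (Suc i) = (if j = 0 then 0 else c (j - 1))" and Si: "Suc i = Suc m - j"
      using j by (auto simp: i_def c_def m_def coeff_eq_0 Suc_diff_le)
    have down: "(if i = 0 then 0 else coeff F (i - 1)) = c (Suc j)"
      using j by (auto simp: i_def c_def)
    have "smult (of_nat (Suc j)) (c (Suc j))
        = smult (of_nat m) (c (Suc j)) - (if i = 0 then 0 else smult (of_nat (i - 1)) (coeff F (i - 1)))"
    proof (cases i)
      case 0
      then show ?thesis using j by (simp add: c_def i_def)
    next
      case (Suc n)
      then have mm: "m = Suc j + n" using j by (simp add: i_def)
      show ?thesis using down Suc unfolding mm by (simp add: smult_add_left)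
    qed
    moreover have "smult 2 (coeff (airy_der F) i) = smult 2 (coeff (G * F) i)" using eq by simp
    then have "smult 2 (pderiv (c j)) + smult (of_nat (Suc i)) ([:1/4, 1:] * coeff F (Suc i))
        - (if i = 0 then 0 else smult (of_nat (i - 1)) (coeff F (i - 1)))
        = smult 2 (\<beta> * c j) - smult (of_nat m) (c (Suc j))"
      unfolding coeff_airy_der GF \<gamma> down[symmetric] using j
      by (simp add: i_def c_def smult_add_right smult_diff_right split: if_splits del: of_nat_Suc of_nat_diff)
    moreover have "smult (of_nat (Suc i)) ([:1/4, 1:] * coeff F (Suc i))
        = (if j = 0 then 0 else smult (of_nat (Suc m - j)) ([:1/4, 1:] * c (j - 1)))"
      unfolding up unfolding Si by simp
    moreover have "x = b - a - v'" if "x = y - r" "a + v - r = b - y" "v = v'"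
      for x y r a b v v' :: "'a poly"
    proof -
      have "a + v' = b - y + r" using that by (simp add: algebra_simps)
      then show ?thesis using that(1) by (simp only: diff_diff_add) simp
    qed
    ultimately show ?thesis by blast
  qed
  have c0: "c 0 \<noteq> 0" and end0: "c (Suc m) = 0" using lc by (simp_all add: c_def)
  show False
  proof (cases "degree \<beta> = 0")
    case False
    then show False using airy_recurrence_nonconst[of m c \<beta>] rec c0 end0 by blast
  next
    case True
    then obtain b where b: "\<beta> = [:b:]" by (rule degree_eq_zeroE)
    have "smult (of_nat (Suc j)) (c (Suc j)) =
      smult (2 * b) (c j) - smult 2 (pderiv (c j))
      - (if j = 0 then 0 else smult (of_nat (Suc m - j)) ([:1/4, 1:] * c (j - 1)))"
      if "j \<le> m" for j
      using rec[OF that] unfolding b by simp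
    then show False using airy_recurrence_const[of m c b] c0 end0 m by blast
  qed
qed

lemma is_idealD:
  assumes "is_ideal I"
  shows "a \<in> I \<Longrightarrow> b \<in> I \<Longrightarrow> a + b \<in> I" "a \<in> I \<Longrightarrow> r * a \<in> I"
    "a \<in> I \<Longrightarrow> a * r \<in> I" "a \<in> I \<Longrightarrow> b \<in> I \<Longrightarrow> a - b \<in> I"
proof -
  show add: "a + b \<in> I" if "a \<in> I" "b \<in> I" for a b using assms that by (simp add: is_ideal_def)
  show mult: "r * a \<in> I" if "a \<in> I" for a r using assms that by (simp add: is_ideal_def)
  show "a * r \<in> I" if "a \<in> I" using mult[OF that, of r] by (simp add: mult.commute)
  show "a - b \<in> I" if "a \<in> I" "b \<in> I" using add[OF that(1) mult[OF that(2), of "-1"]] by simp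
qed

lemma is_ideal_smult:
  assumes "is_ideal I" "p \<in> I"
  shows "smult c p \<in> I"
  using is_idealD(2)[OF assms, of "[:c:]"] by simp

text \<open>
  Over \<open>k(z)\<close> the ideal would be principal, with a generator dividing its derivative. To stay in
  \<open>k[z,s]\<close>, take \<open>F\<close> of least degree in \<open>s\<close> among the nonzero polynomials having a multiple
  \<open>h(z) F\<close> in \<open>J\<close>, and then with leading coefficient of least degree, so that \<open>F\<close> is
  primitive. Pseudo-division gives \<open>a(z) d F = F q\<close>. Each root \<open>x\<close> of \<open>a\<close> yields a prime
  \<open>z - x\<close> dividing \<open>F q\<close>, hence \<open>q\<close>, and can be cancelled; so \<open>F\<close> divides \<open>d F\<close>. By
  \<open>airy_no_darboux\<close>, \<open>J\<close> then meets \<open>k[z]\<close>, where the derivation is \<open>d/dz\<close>.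
\<close>
lemma airy_simple:
  fixes J :: "'k::{alg_closed_field, field_char_0} poly poly set"
  assumes J: "is_ideal J" and stable: "airy_der ` J \<subseteq> J" and F0: "F0 \<in> J" "F0 \<noteq> 0"
  shows "1 \<in> J"
proof -
  \<comment> \<open>\<open>S\<close> is the contraction to \<open>k[z,s]\<close> of the ideal generated by \<open>J\<close> over \<open>k(z)\<close>, without zero.\<close>
  define S where "S F \<longleftrightarrow> F \<noteq> 0 \<and> (\<exists>h. h \<noteq> 0 \<and> smult h F \<in> J)" for F
  have "S F0" using F0 by (auto simp: S_def intro!: exI[of _ 1])
  then obtain F1 where F1: "S F1" "\<And>F'. S F' \<Longrightarrow> degree F1 \<le> degree F'"
    using ex_has_least_nat[of S F0 degree] by blast
  obtain F where "S F \<and> degree F = degree F1"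
      and lcF: "\<And>F'. S F' \<and> degree F' = degree F1 \<Longrightarrow> degree (lead_coeff F) \<le> degree (lead_coeff F')"
    using ex_has_least_nat[of "\<lambda>F. S F \<and> degree F = degree F1" F1 "\<lambda>F. degree (lead_coeff F)"] F1(1)
    by blast
  then have SF: "S F" and degF: "\<And>F'. S F' \<Longrightarrow> degree F \<le> degree F'"
      and lcF: "\<And>F'. S F' \<Longrightarrow> degree F' = degree F \<Longrightarrow> degree (lead_coeff F) \<le> degree (lead_coeff F')"
    using F1 by auto
  obtain h where F: "F \<noteq> 0" and h: "h \<noteq> 0" "smult h F \<in> J" using SF by (auto simp: S_def)
  have "smult h (airy_der (smult h F)) \<in> J"
    using stable h by (intro is_ideal_smult[OF J]) auto
  moreover have "smult (pderiv h) (smult h F) \<in> J" by (rule is_ideal_smult[OF J h(2)])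
  ultimately have "smult h (airy_der (smult h F)) - smult (pderiv h) (smult h F) \<in> J"
    by (rule is_idealD(4)[OF J])
  then have hd: "smult (h * h) (airy_der F) \<in> J"
    by (simp add: airy_der_smult smult_add_right mult.commute)
  let ?Q = "\<lambda>a. a \<noteq> 0 \<and> (\<exists>q. smult a (airy_der F) = F * q)"
  have "\<exists>a. ?Q a"
  proof -
    obtain a q where aq: "a \<noteq> 0" "smult a (airy_der F) = F * q + pseudo_mod (airy_der F) F"
      using pseudo_mod(1)[OF F] by blast
    define r where "r = pseudo_mod (airy_der F) F"
    have r: "r = 0 \<or> degree r < degree F" unfolding r_def by (rule pseudo_mod(2)[OF F])
    have "r = smult a (airy_der F) - q * F" using aq(2) by (simp add: r_def mult.commute)
    then have "smult (h * h) r = smult a (smult (h * h) (airy_der F)) - smult h q * smult h F"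
      by (simp add: smult_diff_right mult_ac)
    also have "\<dots> \<in> J" by (intro is_idealD[OF J] is_ideal_smult[OF J] hd h)
    finally have "smult (h * h) r \<in> J" .
    then have "S r" if "r \<noteq> 0" using that h(1) by (auto simp: S_def intro!: exI[of _ "h * h"])
    then have "r = 0" using r degF[of r] by fastforce
    then show ?thesis using aq by (auto simp: r_def)
  qed
  then obtain a where a: "?Q a" and least: "\<And>a'. ?Q a' \<Longrightarrow> degree a \<le> degree a'"
    using ex_has_least_nat[of ?Q _ degree] by blast
  obtain q where q: "smult a (airy_der F) = F * q" and a0: "a \<noteq> 0" using a by blast
  have "degree a = 0"
  proof (rule ccontr)
    assume "degree a \<noteq> 0"
    then obtain x where "poly a x = 0" using alg_closed_imp_poly_has_root[of a] by blast
    then obtain a' where a': "a = [:-x, 1:] * a'" by (metis dvdE poly_eq_0_iff_dvd)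
    then have a'0: "a' \<noteq> 0" using a0 by auto
    have "prime_elem [:[:-x, 1:]:]"
      by (intro lift_prime_elem_poly prime_elem_linear_field_poly) simp
    moreover have "[:[:-x, 1:]:] * smult a' (airy_der F) = F * q"
      unfolding q[symmetric] a' by simp
    then have "[:[:-x, 1:]:] dvd F * q" by (metis dvd_triv_left)
    ultimately consider "[:[:-x, 1:]:] dvd F" | "[:[:-x, 1:]:] dvd q"
      by (auto simp: prime_elem_dvd_mult_iff)
    then show False
    proof cases
      case 1
      then obtain F' where F': "F = smult [:-x, 1:] F'" by (auto simp: dvd_def)
      have F'0: "F' \<noteq> 0" using F F' by auto
      have "h * [:-x, 1:] \<noteq> 0" unfolding mult_eq_0_iff using h by simp
      then have "S F'" unfolding S_def
        using F'0 h F' by (intro conjI exI[of _ "h * [:-x, 1:]"]) (simp_all del: mult_pCons_right)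
      moreover have "degree F' = degree F" by (simp add: F')
      ultimately have "degree (lead_coeff F) \<le> degree (lead_coeff F')" by (rule lcF)
      moreover have "degree (lead_coeff F) = Suc (degree (lead_coeff F'))"
        unfolding F' lead_coeff_smult using F'0 by (subst degree_mult_eq) auto
      ultimately show False by simp
    next
      case 2
      then obtain q' where q': "q = smult [:-x, 1:] q'" by (auto simp: dvd_def)
      have "smult [:-x, 1:] (smult a' (airy_der F)) = smult [:-x, 1:] (F * q')"
        using q unfolding a' q' by simp
      then have "smult a' (airy_der F) = F * q'" by (rule smult_cancel[rotated]) simp
      then have "degree a \<le> degree a'" using least[of a'] a'0 by blast
      moreover have "degree a = Suc (degree a')"
        unfolding a' using a'0 by (subst degree_mult_eq) auto
      ultimately show False by simp
    qed
  qed
  then obtain a1 where a1: "a = [:a1:]" by (rule degree_eq_zeroE)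
  then have "airy_der F = smult [:1 / a1:] (smult a (airy_der F))" using a0 by (simp flip: one_pCons)
  also have "\<dots> = smult [:1 / a1:] q * F" unfolding q by (simp add: mult.commute)
  finally have "degree F = 0" using airy_no_darboux F by blast
  then obtain g where g: "F = [:g:]" by (rule degree_eq_zeroE)
  \<comment> \<open>Differentiating an element of \<open>J \<inter> k[z]\<close> of least degree shows that it is constant.\<close>
  let ?R = "\<lambda>g. g \<noteq> 0 \<and> [:g:] \<in> J"
  have "?R (h * g)" using h F g by auto
  then obtain g where g: "?R g" and least: "\<And>g'. ?R g' \<Longrightarrow> degree g \<le> degree g'"
    using ex_has_least_nat[of ?R _ degree] by blast
  have "[:pderiv g:] \<in> J" using g stable by (auto simp: airy_der_const[symmetric])
  then have "degree g \<le> degree g - 1" if "degree g \<noteq> 0"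
    using least[of "pderiv g"] that by (simp add: degree_pderiv pderiv_eq_0_iff)
  then have "degree g = 0" by fastforce
  then obtain g1 where g1: "g = [:g1:]" by (rule degree_eq_zeroE)
  have "smult [:1 / g1:] [:g:] \<in> J" using g by (intro is_ideal_smult[OF J]) simp
  then show ?thesis using g by (simp add: g1 flip: one_pCons)
qed

section \<open>The lift of the derivation to \<open>A\<close>\<close>

lift_definition lifted :: "'k::field_char_0 surface \<Rightarrow> 'k surface" is plift
proof -
  fix p q :: "'k poly poly poly"
  assume "surface_rel p q"
  then obtain r where "p = q + surface_poly * r"
    by (auto simp: surface_rel_def dvd_def algebra_simps)
  then have "plift p - plift q = surface_poly * ((pX ^ 2 * pZ - pX ^ 2) * r + plift r)"
    by (simp add: plift_add plift_mult plift_surface_poly algebra_simps)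
  then show "surface_rel (plift p) (plift q)" by (simp add: surface_rel_def)
qed

lemma lifted_add: "lifted (a + b) = lifted a + lifted b"
  by transfer (simp add: plift_add surface_rel_def)

lemma lifted_mult: "lifted (a * b) = lifted a * b + a * lifted b"
  by transfer (simp add: plift_mult surface_rel_def)

lemma lifted_const: "lifted (const c) = 0"
  by transfer (simp add: plift_gens surface_rel_def)

lemma lifted_0: "lifted 0 = 0"
  using lifted_const[of 0] by (simp add: const_0)

lemma lifted_x: "lifted xbar = const (1/2) * (ybar + xbar ^ 3 * zbar - xbar - xbar ^ 3)"
  unfolding power3_eq_cube
  by transfer (simp add: plift_gens surface_rel_def power3_eq_cube)

lemma lifted_y:
  "lifted ybar = const (1/2) * (xbar ^ 2 * ybar * zbar - xbar ^ 2 * ybar + xbar * zbar)"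
  unfolding power2_eq_square
  by transfer (simp add: plift_gens surface_rel_def power2_eq_square)

lemma lifted_z: "lifted zbar = 1"
  by transfer (simp add: plift_gens surface_rel_def)

lemma lifted_uminus: "lifted (- a) = - lifted a"
  using lifted_mult[of "const (-1)" a] unfolding lifted_const by (simp add: const_uminus const_1)

lemma lifted_diff: "lifted (a - b) = lifted a - lifted b"
  using lifted_add[of a "- b"] by (simp add: lifted_uminus)

lemma lifted_power: "lifted (a ^ Suc n) = of_nat (Suc n) * a ^ n * lifted a"
  by (induction n) (simp_all add: lifted_mult algebra_simps)

lemma const_half: "const (1/2) + const (1/2) = (1 :: 'k::field_char_0 surface)"
  by (simp add: const_add[symmetric] const_1)

lemma sigma_lifted: "sigma (lifted a) = lifted (sigma a)"
  by (induction a rule: surface_induct)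
    (simp_all add: sigma_add sigma_mult sigma_gens sigma_diff sigma_uminus lifted_add lifted_mult
      lifted_const lifted_x lifted_y lifted_z lifted_uminus power2_eq_square power3_eq_cube
      algebra_simps sigma_gens(4)[of 0, unfolded const_0] sigma_gens(4)[of 1, unfolded const_1])

lemma lifted_in_Der: "lifted \<in> Der UNIV"
  by (simp add: Der_def lifted_add lifted_mult lifted_const)

lemma lifted_restrict: "restrict lifted B_ring = (calD :: 'k::field_char_0 surface \<Rightarrow> _)"
proof (rule is_calD_unique[OF _ is_calD_calD])
  let ?h = "const (1/2) :: 'k surface"
  have "restrict lifted B_ring \<in> Der (B_ring :: 'k surface set)"
    unfolding Der_def
    by (auto simp: B_ring_closed lifted_add lifted_mult lifted_const PiE_def)
      (simp add: B_ring_def sigma_lifted)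
  moreover have "lifted wbar = (1 :: 'k surface)" by (simp add: wbar_def lifted_z)
  moreover have "lifted ubar = vbar + ubar ^ 2 * wbar - ubar - (ubar :: 'k surface) ^ 2"
  proof -
    have "lifted ubar = (?h + ?h) * (xbar * (ybar + xbar ^ 3 * zbar - xbar - xbar ^ 3))"
      by (simp add: ubar_def power2_eq_square lifted_mult lifted_x algebra_simps)
    then show ?thesis unfolding const_half
      by (simp add: ubar_def vbar_def wbar_def algebra_simps power2_eq_square power3_eq_cube)
  qed
  moreover have "lifted vbar = ubar * vbar * wbar - ubar * vbar + ubar * wbar - ?h * (vbar + 1)"
  proof -
    have "lifted vbar = ?h * (ybar ^ 2) + ?h * (xbar ^ 2 * zbar) - ?h * vbar
      + (?h + ?h) * (ubar * vbar * wbar - ubar * vbar)"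
      by (simp add: vbar_def ubar_def wbar_def lifted_mult lifted_x lifted_y algebra_simps
          power2_eq_square power3_eq_cube)
    also have "\<dots> = (?h + ?h) * (ubar * wbar) - ?h * (vbar + 1)
      + (?h + ?h) * (ubar * vbar * wbar - ubar * vbar)"
      unfolding ybar_squared by (simp add: ubar_def wbar_def algebra_simps)
    finally show ?thesis unfolding const_half by simp
  qed
  ultimately show "is_calD (restrict lifted (B_ring :: 'k surface set))"
    by (simp add: is_calD_def B_ring_closed)
qed

section \<open>Evaluating polynomials along a ring homomorphism\<close>

definition ring_map :: "('a::comm_ring_1 \<Rightarrow> 'b::comm_ring_1) \<Rightarrow> bool" where
  "ring_map h \<longleftrightarrow> h 0 = 0 \<and> h 1 = 1 \<and> (\<forall>a b. h (a + b) = h a + h b) \<and>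
     (\<forall>a b. h (a * b) = h a * h b)"

definition eval_map :: "('a::comm_ring_1 \<Rightarrow> 'b::comm_ring_1) \<Rightarrow> 'b \<Rightarrow> 'a poly \<Rightarrow> 'b" where
  "eval_map h b p = poly (map_poly h p) b"

lemma eval_map_pCons:
  "ring_map h \<Longrightarrow> eval_map h b (pCons c p) = h c + b * eval_map h b p"
  by (simp add: ring_map_def eval_map_def map_poly_pCons)

lemma eval_map_0 [simp]: "eval_map h b 0 = 0"
  by (simp add: eval_map_def)

lemma eval_map_smult:
  "ring_map h \<Longrightarrow> eval_map h b (smult c p) = h c * eval_map h b p"
  by (induction p) (simp_all add: eval_map_pCons ring_map_def algebra_simps)

lemma eval_map_add:
  "ring_map h \<Longrightarrow> eval_map h b (p + q) = eval_map h b p + eval_map h b q"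
proof (induction p arbitrary: q)
  case (pCons c p)
  then show ?case
    by (cases q) (simp_all add: eval_map_pCons ring_map_def algebra_simps)
qed simp

lemma ring_map_eval_map:
  assumes h: "ring_map h"
  shows "ring_map (eval_map h b)"
proof -
  have "eval_map h b (p * q) = eval_map h b p * eval_map h b q" for p q
    by (induction p)
      (use h in \<open>simp_all add: eval_map_pCons eval_map_smult eval_map_add ring_map_def algebra_simps\<close>)
  moreover have "eval_map h b 1 = 1"
    using h unfolding one_pCons by (simp add: eval_map_pCons ring_map_def)
  ultimately show ?thesis
    using h by (simp add: ring_map_def eval_map_add)
qed

lemma ring_mapD:
  assumes "ring_map h"
  shows "h 0 = 0" "h 1 = 1" "h (a + b) = h a + h b" "h (a * b) = h a * h b"
    "h (- a) = - h a" "h (a - b) = h a - h b" "h (a ^ n) = h a ^ n"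
proof -
  show *: "h 0 = 0" "h 1 = 1" "h (a + b) = h a + h b" "h (a * b) = h a * h b" for a b
    using assms by (simp_all add: ring_map_def)
  show m: "h (- a) = - h a" for a
    using *(3)[of a "- a"] *(1) by (simp add: eq_neg_iff_add_eq_0 add.commute)
  show "h (a - b) = h a - h b" using *(3)[of a "- b"] m by simp
  show "h (a ^ n) = h a ^ n" by (induction n) (simp_all add: *)
qed

lemma eval_map_sum:
  assumes h: "ring_map h" and n: "degree p \<le> n"
  shows "eval_map h b p = (\<Sum>i\<le>n. h (coeff p i) * b ^ i)"
  using n
proof (induction p arbitrary: n)
  case 0
  then show ?case using h by (simp add: ring_map_def)
next
  case (pCons c p)
  show ?case
  proof (cases n)
    case 0
    then have "p = 0" using pCons.prems by (simp split: if_splits)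
    then show ?thesis using 0 h by (simp add: eval_map_pCons)
  next
    case (Suc k)
    then have "eval_map h b p = (\<Sum>i\<le>k. h (coeff p i) * b ^ i)"
      using pCons.prems by (intro pCons.IH) (simp split: if_splits)
    then show ?thesis
      unfolding Suc sum.atMost_Suc_shift using h
      by (simp add: eval_map_pCons sum_distrib_left algebra_simps)
  qed
qed

abbreviation zev :: "'k::field poly \<Rightarrow> 'k surface" where
  "zev \<equiv> eval_map const zbar"

lemma ring_map_const: "ring_map const"
  by (simp add: ring_map_def const_0 const_1 const_add const_mult)

lemmas ring_map_zev = ring_map_eval_map[OF ring_map_const, of zbar]

lemma zev_pCons: "zev (pCons c p) = const c + zbar * zev p"
  by (rule eval_map_pCons[OF ring_map_const])

lemma lifted_zev: "lifted (zev p) = zev (pderiv p)"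
  by (induction p)
    (simp_all add: zev_pCons pderiv_pCons lifted_add lifted_mult lifted_const lifted_z lifted_0
      ring_mapD[OF ring_map_zev] const_0)

section \<open>Homogenisation from \<open>k[z,s]\<close> to \<open>A\<close>\<close>

text \<open>The class of \<open>x s\<close>; the shift by \<open>x/2\<close> removes the term linear in \<open>s\<close> from \<open>D(s)\<close>.\<close>
definition ycen :: "'k::field surface" where
  "ycen = ybar - const (1/2) * xbar"

text \<open>
  For \<open>N \<ge> degree f\<close> this is \<open>x\<^sup>N f(z, s)\<close>. For smaller \<open>N\<close> the sum drops the top coefficients, so that
  multiplicativity and change of \<open>N\<close> need the degree bounds.
\<close>
definition hz :: "nat \<Rightarrow> 'k::field poly poly \<Rightarrow> 'k surface" where
  "hz N f = (\<Sum>i\<le>N. zev (coeff f i) * ycen ^ i * xbar ^ (N - i))"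

lemma hz_0 [simp]: "hz N 0 = 0"
  by (simp add: hz_def)

lemma hz_pCons: "hz (Suc N) (pCons c f) = zev c * xbar ^ Suc N + ycen * hz N f"
  unfolding hz_def sum.atMost_Suc_shift by (simp add: sum_distrib_left mult_ac)

lemma hz_const: "hz N [:c:] = zev c * xbar ^ N"
  by (cases N) (simp_all add: hz_pCons, simp add: hz_def)

lemma hz_add: "hz N (f + g) = hz N f + hz N g"
  by (simp add: hz_def ring_mapD[OF ring_map_zev] sum.distrib algebra_simps)

lemma hz_smult: "hz N (smult c f) = zev c * hz N f"
  by (simp add: hz_def ring_mapD[OF ring_map_zev] sum_distrib_left mult_ac)

lemma hz_Suc: "degree f \<le> N \<Longrightarrow> hz (Suc N) f = xbar * hz N f"
  by (simp add: hz_def coeff_eq_0 sum_distrib_left Suc_diff_le mult_ac)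

lemma hz_raise: "degree f \<le> N \<Longrightarrow> hz (N + k) f = xbar ^ k * hz N f"
  by (induction k) (simp_all add: hz_Suc mult_ac)

lemma hz_mult:
  "degree f \<le> M \<Longrightarrow> degree g \<le> N \<Longrightarrow> hz (M + N) (f * g) = hz M f * hz N g"
proof (induction f arbitrary: M)
  case (pCons c f)
  show ?case
  proof (cases M)
    case 0
    then have "f = 0" using pCons.prems by (simp split: if_splits)
    then show ?thesis using 0 by (simp add: hz_smult hz_const)
  next
    case (Suc K)
    then have "degree f \<le> K" using pCons.prems by (simp split: if_splits)
    then have IH: "hz (K + N) (f * g) = hz K f * hz N g" using pCons by blast
    have "hz (Suc (K + N)) (smult c g) = zev c * (xbar ^ Suc K * hz N g)"
      using hz_raise[OF pCons.prems(2), of "Suc K"] by (simp add: hz_smult add.commute)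
    then show ?thesis
      unfolding Suc add_Suc mult_pCons_left hz_add hz_pCons IH
      by (simp add: ring_mapD[OF ring_map_zev] algebra_simps)
  qed
qed simp

lemma const_fractions:
  "const (1/4) = const (1/2) * const (1/2 :: 'k::field_char_0)"
  "const (1/8) = const (1/2) * const (1/2) * const (1/2 :: 'k)"
  by (simp_all add: const_mult[symmetric])

lemma hz_2: "hz 2 [:a, b, c:] = zev a * xbar ^ 2 + zev b * xbar * ycen + zev c * ycen ^ 2"
  unfolding numeral_2_eq_2 hz_pCons hz_const
  by (simp add: algebra_simps hz_def)

text \<open>Both sides are \<open>x\<^sup>2 D(s)\<close>: this is where the Riccati equation enters.\<close>
lemma hz_airy_drift: "hz 2 airy_drift = xbar * lifted ycen - ycen * lifted xbar"
proof -
  let ?h = "const (1/2)"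
  have "hz 2 airy_drift = ?h * (?h * ?h + zbar) * xbar ^ 2 - ?h * ycen ^ 2"
    unfolding airy_drift_def hz_2
    by (simp add: zev_pCons const_uminus[of "1/2", simplified] const_fractions const_0 algebra_simps)
  also have "\<dots> = ?h * (zbar * xbar ^ 2 - ybar ^ 2 + (?h + ?h) * (xbar * ybar))"
    unfolding ycen_def by (simp add: algebra_simps power2_eq_square)
  also have "\<dots> = ?h * (zbar * xbar ^ 2 - ybar ^ 2 + xbar * ybar)"
    unfolding const_half by simp
  also have "\<dots> = xbar * lifted ycen - ycen * lifted xbar"
    unfolding ycen_def
    by (simp add: lifted_diff lifted_mult lifted_const lifted_x lifted_y algebra_simps
        power2_eq_square power3_eq_cube)
  finally show ?thesis .
qed

text \<open>The polynomial \<open>z - (s + 1/2)\<^sup>2\<close>, which represents \<open>1/x\<^sup>2\<close>.\<close>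
definition recip_x2 :: "'k::field_char_0 poly poly" where
  "recip_x2 = [:[:-1/4, 1:], -1, -1:]"

lemma hz_recip_x2: "hz 2 recip_x2 = (1 :: 'k::field_char_0 surface)"
proof -
  let ?h = "const (1/2) :: 'k surface"
  have m1: "zev (-1) = (-1 :: 'k surface)"
    by (simp add: ring_mapD[OF ring_map_zev])
  have "hz 2 recip_x2 = (- (?h * ?h) + zbar) * xbar ^ 2 - xbar * ycen - ycen ^ 2"
    unfolding recip_x2_def hz_2 m1
    by (simp add: zev_pCons const_uminus[of "1/4", simplified] const_fractions const_1 algebra_simps)
  also have "\<dots> = (xbar ^ 2 * zbar - ybar ^ 2 - 1) + 1 + (?h + ?h - 1) * (xbar * ybar)
      + ?h * (1 - (?h + ?h)) * xbar ^ 2"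
    unfolding ycen_def by (simp add: algebra_simps power2_eq_square)
  also have "\<dots> = 1" unfolding const_half surface_equation by simp
  finally show ?thesis .
qed

lemma degree_airy_der: "degree (airy_der f) \<le> Suc (degree f)"
  by (rule degree_le) (auto simp: coeff_airy_der coeff_eq_0)

text \<open>The product rule \<open>D(x\<^sup>N f) = N x\<^bsup>N-1\<^esup> D(x) f + x\<^sup>N D(f)\<close>, multiplied by \<open>x\<^sup>2\<close>.\<close>
lemma hz_airy_der:
  fixes f :: "'k::field_char_0 poly poly"
  shows "degree f \<le> N \<Longrightarrow>
    hz (N + 2) (airy_der f) = xbar ^ 2 * lifted (hz N f) - of_nat N * xbar * lifted xbar * hz N f"
proof (induction f arbitrary: N)
  case 0
  then show ?case by (simp add: airy_der_def lifted_0)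
next
  case (pCons c f)
  show ?case
  proof (cases N)
    case 0
    then have "f = 0" using pCons.prems by (simp split: if_splits)
    then show ?thesis
      using 0 by (simp add: airy_der_const hz_const lifted_zev mult_ac power2_eq_square)
  next
    case (Suc K)
    then have K: "degree f \<le> K" using pCons.prems by (simp split: if_splits)
    have drift: "hz (K + 3) (airy_drift * f) = (xbar * lifted ycen - ycen * lifted xbar) * (xbar * hz K f)"
    proof -
      have "degree (airy_drift :: 'k poly poly) \<le> 2" by (simp add: airy_drift_def)
      then have "hz (2 + Suc K) (airy_drift * f) = hz 2 airy_drift * hz (Suc K) f"
        using K by (intro hz_mult) simp_all
      then show ?thesis unfolding hz_airy_drift hz_Suc[OF K] by (simp add: numeral_3_eq_3)
    qed
    have "hz (Suc (K + 2)) (pCons 0 (airy_der f)) = ycen * hz (K + 2) (airy_der f)"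
      unfolding hz_pCons by (simp add: ring_mapD[OF ring_map_zev])
    then have shift: "hz (K + 3) (pCons 0 (airy_der f))
        = ycen * (xbar ^ 2 * lifted (hz K f) - of_nat K * xbar * lifted xbar * hz K f)"
      unfolding pCons.IH[OF K] by (simp add: numeral_3_eq_3)
    have "hz (N + 2) (airy_der (pCons c f)) =
      zev (pderiv c) * xbar ^ (K + 3)
      + (xbar * lifted ycen - ycen * lifted xbar) * (xbar * hz K f)
      + ycen * (xbar ^ 2 * lifted (hz K f) - of_nat K * xbar * lifted xbar * hz K f)"
    proof -
      have "N + 2 = K + 3" using Suc by simp
      then show ?thesis by (simp only: airy_der_pCons hz_add hz_const drift shift)
    qed
    also have "\<dots> = xbar ^ 2 * lifted (hz N (pCons c f))
        - of_nat N * xbar * lifted xbar * hz N (pCons c f)"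
      unfolding Suc hz_pCons lifted_add lifted_mult lifted_zev lifted_power
      by (simp add: algebra_simps power2_eq_square power3_eq_cube power_add)
    finally show ?thesis .
  qed
qed

section \<open>Polynomials in \<open>z\<close> and \<open>x\<^sup>2\<close> in a nonzero ideal\<close>

text \<open>
  In this part \<open>k[z,x]\<close> is represented as \<open>k[z][x]\<close> with outer variable \<open>x\<close>.
\<close>

lemma surface_decomp:
  "\<exists>P Q. a = eval_map zev xbar P + ybar * eval_map zev xbar (Q :: 'k::field poly poly)"
proof -
  let ?E = "eval_map zev xbar :: 'k poly poly \<Rightarrow> _"
  have E: "ring_map ?E" by (rule ring_map_eval_map[OF ring_map_zev])
  have Ec: "?E [:c:] = zev c" for c by (simp add: eval_map_pCons[OF ring_map_zev])
  have z: "zev [:0, 1:] = (zbar :: 'k surface)" by (simp add: zev_pCons const_0 const_1)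
  have x: "?E [:0, 1:] = xbar"
    by (simp add: eval_map_pCons[OF ring_map_zev] ring_mapD[OF ring_map_zev])
  show ?thesis
  proof (induction a rule: surface_induct)
    case (const c)
    have "const c = ?E [:[:c:]:] + ybar * ?E 0" by (simp add: Ec zev_pCons)
    then show ?case by blast
  next
    case (add a b)
    then obtain P Q P' Q' where "a = ?E P + ybar * ?E Q" "b = ?E P' + ybar * ?E Q'" by blast
    then have "a + b = ?E (P + P') + ybar * ?E (Q + Q')"
      by (simp add: ring_mapD[OF E] algebra_simps)
    then show ?case by blast
  next
    case (x a)
    then obtain P Q where "a = ?E P + ybar * ?E Q" by blast
    then have "xbar * a = ?E ([:0, 1:] * P) + ybar * ?E ([:0, 1:] * Q)"
      unfolding ring_mapD(4)[OF E] \<open>?E [:0, 1:] = xbar\<close> by (simp add: algebra_simps)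
    then show ?case by blast
  next
    case (y a)
    then obtain P Q where a: "a = ?E P + ybar * ?E Q" by blast
    have "?E [:-1, 0, [:0, 1:]:] = xbar ^ 2 * zbar - 1"
      by (simp add: eval_map_pCons[OF ring_map_zev] ring_mapD[OF ring_map_zev] z algebra_simps
          power2_eq_square)
    then have "?E ([:-1, 0, [:0, 1:]:] * Q) = ybar ^ 2 * ?E Q"
      unfolding ring_mapD(4)[OF E] by (simp add: ybar_squared)
    then have "ybar * a = ?E ([:-1, 0, [:0, 1:]:] * Q) + ybar * ?E P"
      by (simp add: a algebra_simps power2_eq_square)
    then show ?case by blast
  next
    case (z a)
    then obtain P Q where "a = ?E P + ybar * ?E Q" by blast
    then have "zbar * a = ?E ([:[:0, 1:]:] * P) + ybar * ?E ([:[:0, 1:]:] * Q)"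
      unfolding ring_mapD(4)[OF E] Ec \<open>zev [:0, 1:] = zbar\<close> by (simp add: algebra_simps)
    then show ?case by blast
  qed
qed

text \<open>
  The norm of \<open>P + y Q\<close> over \<open>k[z,x]\<close>, using \<open>y\<^sup>2 = x\<^sup>2z - 1\<close>. If it vanished, the leading coefficients in
  \<open>x\<close> would satisfy \<open>p\<^sup>2 = z q\<^sup>2\<close> in \<open>k[z]\<close>, against parity of degrees.
\<close>
lemma norm_y_nonzero:
  fixes P Q :: "'k::field poly poly"
  assumes "P \<noteq> 0 \<or> Q \<noteq> 0"
  shows "P ^ 2 - [:-1, 0, [:0, 1:]:] * Q ^ 2 \<noteq> 0"
proof
  assume "P ^ 2 - [:-1, 0, [:0, 1:]:] * Q ^ 2 = 0"
  then have eq: "P ^ 2 = [:-1, 0, [:0, 1:]:] * Q ^ 2" by simp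
  then have Q: "Q \<noteq> 0" using assms by (auto simp: power2_eq_square)
  then have "[:-1, 0, [:0, 1 :: 'k:]:] * Q ^ 2 \<noteq> 0" unfolding mult_eq_0_iff by simp
  then have P: "P \<noteq> 0" unfolding eq[symmetric] by auto
  have "lead_coeff (P ^ 2) = lead_coeff [:-1, 0, [:0, 1 :: 'k:]:] * lead_coeff (Q ^ 2)"
    unfolding eq by (rule lead_coeff_mult)
  then have lc: "lead_coeff P ^ 2 = [:0, 1:] * lead_coeff Q ^ 2"
    by (simp add: lead_coeff_power)
  have "degree (lead_coeff P ^ 2) = degree ([:0, 1:] * lead_coeff Q ^ 2)" unfolding lc ..
  moreover have "degree ([:0, 1:] * lead_coeff Q ^ 2) = 1 + 2 * degree (lead_coeff Q)"
    using Q by (subst degree_mult_eq) (auto simp: degree_power_eq)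
  ultimately have "2 * degree (lead_coeff P) = 1 + 2 * degree (lead_coeff Q)"
    using P by (simp add: degree_power_eq)
  then show False by presburger
qed

text \<open>The norm of \<open>P + x Q\<close> over the polynomials in \<open>x\<^sup>2\<close>; parity of degrees again.\<close>
lemma norm_x_nonzero:
  fixes P Q :: "'a::idom poly"
  assumes "P \<noteq> 0 \<or> Q \<noteq> 0"
  shows "P ^ 2 - [:0, 1:] * Q ^ 2 \<noteq> 0"
proof
  assume "P ^ 2 - [:0, 1:] * Q ^ 2 = 0"
  then have eq: "P ^ 2 = [:0, 1:] * Q ^ 2" by simp
  then have Q: "Q \<noteq> 0" and P: "P \<noteq> 0" using assms by (auto simp: power2_eq_square)
  have "degree (P ^ 2) = degree ([:0, 1:] * Q ^ 2)" unfolding eq ..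
  moreover have "degree ([:0, 1:] * Q ^ 2) = 1 + 2 * degree Q"
    using Q by (subst degree_mult_eq) (auto simp: degree_power_eq)
  ultimately have "2 * degree P = 1 + 2 * degree Q"
    using P by (simp add: degree_power_eq)
  then show False by presburger
qed

lemma eval_map_even_odd:
  assumes h: "ring_map h"
  shows "\<exists>n0 n1. eval_map h b n = eval_map h (b ^ 2) n0 + b * eval_map h (b ^ 2) n1 \<and>
    (n \<noteq> 0 \<longrightarrow> n0 \<noteq> 0 \<or> n1 \<noteq> 0)"
proof (induction n)
  case 0
  show ?case by (rule exI[of _ 0], rule exI[of _ 0]) simp
next
  case (pCons c n)
  then obtain n0 n1 where n: "eval_map h b n = eval_map h (b ^ 2) n0 + b * eval_map h (b ^ 2) n1"
    "n \<noteq> 0 \<longrightarrow> n0 \<noteq> 0 \<or> n1 \<noteq> 0" by blast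
  have "eval_map h b (pCons c n) = eval_map h (b ^ 2) (pCons c n1) + b * eval_map h (b ^ 2) n0"
    by (simp add: eval_map_pCons[OF h] n algebra_simps power2_eq_square)
  then show ?case using n(2) by (metis pCons_eq_0_iff)
qed

text \<open>
  \<open>m\<close> is the norm of \<open>a\<close>, taken first down to \<open>k[z,x]\<close> and then to \<open>k[z,x\<^sup>2]\<close>. It lies in the ideal
  because a norm is a multiple of the element.
\<close>
lemma ideal_contains_even:
  fixes I :: "'k::field surface set"
  assumes I: "is_ideal I" and a: "a \<in> I" "a \<noteq> 0"
  shows "\<exists>m. m \<noteq> 0 \<and> eval_map zev (xbar ^ 2) m \<in> I"
proof -
  let ?E = "eval_map zev xbar :: 'k poly poly \<Rightarrow> _"
  let ?F = "eval_map zev (xbar ^ 2) :: 'k poly poly \<Rightarrow> _"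
  have E: "ring_map ?E" and F: "ring_map ?F" by (rule ring_map_eval_map[OF ring_map_zev])+
  obtain P Q where PQ: "a = ?E P + ybar * ?E Q" using surface_decomp by blast
  define n where "n = P ^ 2 - [:-1, 0, [:0, 1:]:] * Q ^ 2"
  have "P \<noteq> 0 \<or> Q \<noteq> 0" using PQ a by auto
  then have n0: "n \<noteq> 0" unfolding n_def by (rule norm_y_nonzero)
  have z: "zev [:0, 1:] = (zbar :: 'k surface)" by (simp add: zev_pCons const_0 const_1)
  have "?E [:-1, 0, [:0, 1:]:] = ybar ^ 2"
    by (simp add: eval_map_pCons[OF ring_map_zev] ring_mapD[OF ring_map_zev] z algebra_simps
        power2_eq_square ybar_squared[unfolded power2_eq_square])
  then have "?E n = a * (?E P - ybar * ?E Q)"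
    unfolding n_def ring_mapD(4,6)[OF E] by (simp add: PQ ring_mapD[OF E] algebra_simps power2_eq_square)
  then have nI: "?E n \<in> I" using is_idealD(3)[OF I a(1)] by simp
  obtain n0 n1 where ev: "?E n = ?F n0 + xbar * ?F n1" "n0 \<noteq> 0 \<or> n1 \<noteq> 0"
    using eval_map_even_odd[OF ring_map_zev, of xbar n] n0 by blast
  define m where "m = n0 ^ 2 - [:0, 1:] * n1 ^ 2"
  have square_diff: "X ^ 2 - xbar ^ 2 * Y ^ 2 = (X + xbar * Y) * (X - xbar * Y)"
    for X Y :: "'k surface"
    by (simp add: algebra_simps power2_eq_square)
  have "m \<noteq> 0" unfolding m_def using ev(2) by (rule norm_x_nonzero)
  moreover have "?F [:0, 1:] = xbar ^ 2"
    by (simp add: eval_map_pCons[OF ring_map_zev] ring_mapD[OF ring_map_zev])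
  then have "?F m = ?E n * (?F n0 - xbar * ?F n1)"
    unfolding m_def ring_mapD(4,6,7)[OF F] ev(1) square_diff[symmetric] by simp
  then have "?F m \<in> I" using is_idealD(3)[OF I nI] by simp
  ultimately show ?thesis by blast
qed

lemma hz_pcompose:
  "degree q \<le> K \<Longrightarrow> hz (2 * K) (pcompose q recip_x2)
    = (\<Sum>i\<le>K. zev (coeff q i) * (xbar ^ 2) ^ (K - i))"
proof (induction q arbitrary: K)
  case 0
  then show ?case by (simp add: ring_mapD[OF ring_map_zev])
next
  case (pCons c q)
  show ?case
  proof (cases K)
    case 0
    then have "q = 0" using pCons.prems by (simp split: if_splits)
    then show ?thesis using 0 by (simp add: hz_const)
  next
    case (Suc L)
    then have L: "degree q \<le> L" using pCons.prems by (simp split: if_splits)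
    have "degree (pcompose q recip_x2) \<le> 2 * L"
      using L by (simp add: degree_pcompose recip_x2_def)
    then have "hz (2 + 2 * L) (recip_x2 * pcompose q recip_x2) = hz (2 * L) (pcompose q recip_x2)"
      by (subst hz_mult) (simp_all add: hz_recip_x2, simp add: recip_x2_def)
    then show ?thesis
      unfolding Suc sum.atMost_Suc_shift using pCons.IH[OF L]
      by (simp add: pcompose_pCons hz_add hz_const power_mult power2_eq_square power_mult_distrib mult_ac)
  qed
qed

text \<open>
  A polynomial \<open>m\<close> in \<open>x\<^sup>2\<close> of degree \<open>M\<close> is \<open>x\<^bsup>2M\<^esup>\<close> times the reversed polynomial in \<open>1/x\<^sup>2\<close>, and
  \<open>1/x\<^sup>2\<close> lies in \<open>k[z,s]\<close>.
\<close>
lemma hz_reflect: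
  "hz (2 * degree m) (pcompose (reflect_poly m) recip_x2) = eval_map zev (xbar ^ 2) m"
proof -
  have "hz (2 * degree m) (pcompose (reflect_poly m) recip_x2) =
    (\<Sum>i\<le>degree m. zev (coeff (reflect_poly m) i) * (xbar ^ 2) ^ (degree m - i))"
    by (rule hz_pcompose) (rule degree_reflect_poly_le)
  also have "\<dots> = (\<Sum>i\<le>degree m. zev (coeff m i) * (xbar ^ 2) ^ i)"
    by (rule sum.reindex_bij_witness[of _ "\<lambda>i. degree m - i" "\<lambda>i. degree m - i"])
      (auto simp: coeff_reflect_poly)
  also have "\<dots> = eval_map zev (xbar ^ 2) m"
    by (rule eval_map_sum[OF ring_map_zev, symmetric]) simp
  finally show ?thesis .
qed

section \<open>Simplicity of the lift\<close>

text \<open>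
  \<open>J\<close> is the contraction to \<open>k[z,s]\<close> of the localisation of \<open>I\<close> at \<open>x\<close>. It is stable and nonzero, hence
  contains \<open>1\<close>, whose homogenisations are the powers of \<open>x\<close>.
\<close>
lemma ideal_power_x:
  fixes I :: "'k::{alg_closed_field, field_char_0} surface set"
  assumes I: "is_ideal I" and stable: "lifted ` I \<subseteq> I" and a: "a \<in> I" "a \<noteq> 0"
  shows "\<exists>N. xbar ^ N \<in> I"
proof -
  define J :: "'k poly poly set" where "J = {f. \<exists>N. degree f \<le> N \<and> hz N f \<in> I}"
  have raise: "hz (N + k) f \<in> I" if "degree f \<le> N" "hz N f \<in> I" for f :: "'k poly poly" and N k
    unfolding hz_raise[OF that(1)] by (rule is_idealD(2)[OF I that(2)])
  have "is_ideal J"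
    unfolding is_ideal_def
  proof (intro conjI ballI allI)
    show "0 \<in> J" using I by (auto simp: J_def is_ideal_def)
  next
    fix f g assume "f \<in> J" "g \<in> J"
    then obtain M N where f: "degree f \<le> M" "hz M f \<in> I" and g: "degree g \<le> N" "hz N g \<in> I"
      by (auto simp: J_def)
    have "degree (f + g) \<le> M + N" using f(1) g(1) by (intro degree_add_le) auto
    moreover have "hz (M + N) (f + g) \<in> I"
      unfolding hz_add using raise[OF f, of N] raise[OF g, of M]
      by (intro is_idealD(1)[OF I]) (simp_all add: add.commute)
    ultimately show "f + g \<in> J" by (auto simp: J_def)
  next
    fix r f assume "f \<in> J"
    then obtain M where f: "degree f \<le> M" "hz M f \<in> I" by (auto simp: J_def)
    have "degree (r * f) \<le> degree r + M" using f(1) degree_mult_le[of r f] by linarith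
    moreover have "hz (degree r + M) (r * f) \<in> I"
      unfolding hz_mult[OF order_refl f(1)] by (rule is_idealD(2)[OF I f(2)])
    ultimately show "r * f \<in> J" unfolding J_def by blast
  qed
  moreover have "airy_der ` J \<subseteq> J"
  proof
    fix g assume "g \<in> airy_der ` J"
    then obtain f N where g: "g = airy_der f" and f: "degree f \<le> N" "hz N f \<in> I"
      by (auto simp: J_def)
    have "hz (N + 2) g \<in> I"
      unfolding g hz_airy_der[OF f(1)]
      using f(2) stable by (intro is_idealD(2,4)[OF I]) auto
    moreover have "degree g \<le> N + 2" using degree_airy_der[of f] f(1) by (simp add: g)
    ultimately show "g \<in> J" unfolding J_def by blast
  qed
  moreover obtain m where m: "m \<noteq> 0" "eval_map zev (xbar ^ 2) m \<in> I"
    using ideal_contains_even[OF I a] by blast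
  let ?f = "pcompose (reflect_poly m) recip_x2"
  have "?f \<noteq> 0" using m(1) pcompose_eq_0[of "reflect_poly m" recip_x2] by (auto simp: recip_x2_def)
  moreover have "degree ?f \<le> 2 * degree m"
    using degree_reflect_poly_le[of m] by (simp add: degree_pcompose recip_x2_def)
  then have "?f \<in> J" using m(2) hz_reflect[of m] unfolding J_def by (metis (mono_tags) mem_Collect_eq)
  ultimately have "1 \<in> J" using airy_simple by blast
  then obtain N where "hz N (1 :: 'k poly poly) \<in> I" by (auto simp: J_def)
  then have "xbar ^ N \<in> I"
    unfolding one_pCons hz_const by (simp add: ring_mapD[OF ring_map_zev, simplified one_pCons] zev_pCons const_1)
  then show ?thesis by blast
qed

lemma const_of_nat: "const (of_nat n) = of_nat n"
  by (induction n) (simp_all add: const_add const_0 const_1)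

text \<open>
  The lines \<open>x = 0\<close> are not invariant: \<open>D(x\<^bsup>N+1\<^esup>)\<close> is \<open>(N+1) x\<^sup>N y/2\<close> modulo \<open>x\<^bsup>N+1\<^esup>\<close>, and
  \<open>y\<close> is a unit modulo \<open>x\<close> because \<open>y\<^sup>2 = x\<^sup>2z - 1\<close>.
\<close>
lemma lower_power_x:
  assumes I: "is_ideal I" and stable: "lifted ` I \<subseteq> I" and N: "xbar ^ Suc N \<in> I"
  shows "xbar ^ N \<in> (I :: 'k::field_char_0 surface set)"
proof -
  let ?h = "const (1/2) :: 'k surface" and ?n = "of_nat (Suc N) :: 'k"
  have "lifted (xbar ^ Suc N) \<in> I" using stable N by blast
  moreover have "lifted (xbar ^ Suc N) =
      const ?n * ?h * (xbar ^ N * ybar)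
      + const ?n * ?h * (xbar ^ 2 * zbar - 1 - xbar ^ 2) * xbar ^ Suc N"
    unfolding lifted_power lifted_x const_of_nat
    by (simp add: algebra_simps power2_eq_square power3_eq_cube)
  ultimately have "const ?n * ?h * (xbar ^ N * ybar) \<in> I"
    using is_idealD(4)[OF I, of "lifted (xbar ^ Suc N)"
        "const ?n * ?h * (xbar ^ 2 * zbar - 1 - xbar ^ 2) * xbar ^ Suc N"]
      is_idealD(2)[OF I N] by (simp del: power_Suc of_nat_Suc)
  then have "const (2 / ?n) * (const ?n * ?h * (xbar ^ N * ybar)) \<in> I"
    by (rule is_idealD(2)[OF I])
  moreover have "const (2 / ?n) * (const ?n * ?h * (xbar ^ N * ybar))
      = const (2 / ?n * ?n * (1/2)) * (xbar ^ N * ybar)"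
    by (simp only: const_mult mult.assoc)
  ultimately have "xbar ^ N * ybar \<in> I" by (simp add: const_1 del: of_nat_Suc)
  then have "(xbar * zbar) * xbar ^ Suc N - ybar * (xbar ^ N * ybar) \<in> I"
    by (rule is_idealD(4)[OF I is_idealD(2)[OF I N] is_idealD(2)[OF I]])
  moreover have "(xbar * zbar) * xbar ^ Suc N - ybar * (xbar ^ N * ybar)
      = xbar ^ N * (xbar ^ 2 * zbar - ybar ^ 2)"
    by (simp add: algebra_simps power2_eq_square)
  moreover have "xbar ^ 2 * zbar - ybar ^ 2 = (1 :: 'k surface)" unfolding ybar_squared by simp
  ultimately show ?thesis by (metis mult_1_right)
qed

lemma lifted_simple: "simple_derivation (lifted :: 'k::{alg_closed_field, field_char_0} surface \<Rightarrow> _)"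
  unfolding simple_derivation_def
proof (intro allI impI)
  fix I :: "'k surface set"
  assume "is_ideal I \<and> lifted ` I \<subseteq> I"
  then have I: "is_ideal I" and stable: "lifted ` I \<subseteq> I" by auto
  show "I = {0} \<or> I = UNIV"
  proof (cases "\<exists>a\<in>I. a \<noteq> 0")
    case False
    moreover have "0 \<in> I" using I by (simp add: is_ideal_def)
    ultimately show ?thesis by blast
  next
    case True
    then obtain N where N: "xbar ^ N \<in> I" using ideal_power_x[OF I stable] by blast
    have "xbar ^ N \<in> I \<Longrightarrow> xbar ^ 0 \<in> I"
      by (induction N) (use lower_power_x[OF I stable] in auto)
    then have "1 \<in> I" using N by simp
    then have "r \<in> I" for r using is_idealD(2)[OF I, of 1 r] by simp
    then show ?thesis by blast
  qed
qed

lemma xbar_nonzero: "xbar \<noteq> (0 :: 'k::field_char_0 surface)"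
proof
  assume x: "xbar = (0 :: 'k surface)"
  have "is_ideal {0 :: 'k surface}" "lifted ` {0 :: 'k surface} \<subseteq> {0}"
    by (simp_all add: is_ideal_def lifted_0)
  then have "xbar ^ 0 \<in> {0 :: 'k surface}" by (rule lower_power_x) (simp add: x)
  then show False by simp
qed

theorem mainTheorem2:
  shows "\<exists>D :: 'k::{alg_closed_field, field_char_0} surface \<Rightarrow> 'k surface.
    D \<in> Der UNIV \<and> simple_derivation D \<and>
    restrict D B_ring = calD \<and>
    sigma \<circ> D = D \<circ> sigma \<and>
    sigma \<in> Aut_commuting D \<and> Aut_commuting D \<noteq> {id}"
proof (intro exI conjI)
  show comm: "sigma \<circ> lifted = (lifted \<circ> sigma :: 'k surface \<Rightarrow> _)"
    by (simp add: fun_eq_iff sigma_lifted)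
  show aut: "sigma \<in> Aut_commuting (lifted :: 'k surface \<Rightarrow> _)"
    by (simp add: Aut_commuting_def sigma_automorphism comm)
  have "sigma \<noteq> (id :: 'k surface \<Rightarrow> _)"
  proof
    assume "sigma = (id :: 'k surface \<Rightarrow> _)"
    then have "xbar = - (xbar :: 'k surface)" using sigma_gens(1) by (metis id_apply)
    then have "xbar + xbar = (0 :: 'k surface)" by (simp add: eq_neg_iff_add_eq_0)
    then have "(const (1/2) + const (1/2)) * xbar = (0 :: 'k surface)"
      by (metis distrib_left distrib_right mult_zero_right)
    then show False using xbar_nonzero[where ?'k = 'k] unfolding const_half by simp
  qed
  then show "Aut_commuting (lifted :: 'k surface \<Rightarrow> _) \<noteq> {id}" using aut by blast
qed (rule lifted_in_Der lifted_simple lifted_restrict)+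

end
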